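(* The double-decomposition (DD) algorithm (defined in the context) returns an optimal solution to Problem $(\mathrm{MIO\text{-}LO})$ in a finite number of iterations, along with an optimality gap for Problem $(\star)$. (The gap is the valid pair of bounds formed by the optimal value of $(\mathrm{MIO\text{-}LO})$, which is a lower bound on the optimal value of $(\star)$, and by the total cost of the feasible solution of $(\star)$ derived at termination, which is an upper bound on it.)
   Context: **Problem $(\star)$.** Let $\mathcal S$ be a set of scenarios, scenario $s$ having probability $\pi_s$, and let the first-stage indices be partitioned into sets $\mathcal K_j$, $j\in\mathcal J$. The first-stage vector $x$ satisfies $Ax\ge b$ and $x\in\mathcal X^{\mathrm{MIO}}$, a mixed-integer region (some components integer, the others continuous). For each $s\in\mathcal S$, $j\in\mathcal J$ there is a network with node set $\mathcal N_{sj}$ and arc set $\mathcal A_{sj}$; there are second-stage variables $y_a\in\mathcal Y^{\mathrm{MIO}}_a$ for $a\in\mathcal A_{sj}$ (the sets $\mathcal Y^{\mathrm{MIO}}_a$ encode discrete requirements), costs $g_a$, scalars $b_{nsk}$, and vectors $f_{a,s,j}$ and $h_{sj}$. Problem $(\star)$ is $$\min\ \sum_{j\in\mathcal J}\sum_{k\in\mathcal K_j}c_kx_k+\sum_{s\in\mathcal S}\sum_{j\in\mathcal J}\pi_s\sum_{a\in\mathcal A_{sj}}g_ay_a$$ subject to $Ax\ge b$, $x\in\mathcal X^{\mathrm{MIO}}$, $y_a\in\mathcal Y_a^{\mathrm{MIO}}$ and, for all $s,j$, (FB) $\sum_{m:(n,m)\in\mathcal A_{sj}}y_{(n,m)}-\sum_{m:(m,n)\in\mathcal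 A_{sj}}y_{(m,n)}=\sum_{k\in\mathcal K_j}b_{nsk}x_k$ for all $n\in\mathcal N_{sj}$; (SC) $\sum_{a\in\mathcal A_{sj}}f_{a,s,j}\,y_a\ge h_{sj}$. **Partial relaxation and second-stage problems.** $(\mathrm{MIO\text{-}LO})$ is the relaxation of $(\star)$ that keeps the mixed-integer first stage $x\in\mathcal X^{\mathrm{MIO}}$ and makes the second stage continuous, i.e. replaces $y_a\in\mathcal Y_a^{\mathrm{MIO}}$ by $y_a\ge0$. For fixed $x$, the second-stage problem (with integrality requirements) minimizes $\sum_{s,j}\pi_s\sum_{a\in\mathcal A_{sj}}g_ay_a$ subject to (FB), (SC), $y_a\in\mathcal Y^{\mathrm{MIO}}_a$; it separates over $(s,j)$. The Benders subproblem for $(s,j)$ is to minimize $\sum_{a\in\mathcal A_{sj}}g_ay_a$ subject to (FB), (SC), $y\ge0$. Its dual is $$\max\Big\{\sum_{n\in\mathcal N_{sj}}\sum_{k\in\mathcal K_j}b_{nsk}x_k\psi_{sjn}+h_{sj}^\top\gamma_{sj}:(\psi_{sj},\gamma_{sj})\in\mathcal P_{sj}\Big\},$$ $$\mathcal P_{sj}=\{(\psi_{sj},\gamma_{sj}):\gamma_{sj}\ge0,\ \psi_{sjm}-\psi_{sjn}+\gamma_{sj}^\top f_{(m,n),s,j}\le g_{(m,n)}\ \forall(m,n)\in\mathcal A_{sj}\}.$$ The extreme points of $\mathcal P_{sj}$ are indexed as $\{(\psi^u_{sj},\gamma^u_{sj}):u\in\mathcal U_{sj}\}$ and its extreme rays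 as $\{(\psi^v_{sj},\gamma^v_{sj}):v\in\mathcal V_{sj}\}$. **DD algorithm.** *Outer loop (Benders decomposition).* Given subsets $\mathcal U^0_{sj}\subseteq\mathcal U_{sj}$ and $\mathcal V^0_{sj}\subseteq\mathcal V_{sj}$, solve the master problem $$\min\ \sum_{j}\sum_{k\in\mathcal K_j}c_kx_k+\sum_{s,j}\pi_s\theta_{sj}$$ subject to $Ax\ge b$, $x\in\mathcal X^{\mathrm{MIO}}$ and, for all $s,j$, the optimality cuts $\theta_{sj}\ge\sum_{n\in\mathcal N_{sj}}\sum_{k\in\mathcal K_j}b_{nsk}x_k\psi^u_{sjn}+h_{sj}^\top\gamma^u_{sj}$ ($u\in\mathcal U^0_{sj}$) and the feasibility cuts $0\ge\sum_{n\in\mathcal N_{sj}}\sum_{k\in\mathcal K_j}b_{nsk}x_k\psi^v_{sjn}+h_{sj}^\top\gamma^v_{sj}$ ($v\in\mathcal V^0_{sj}$). If it is infeasible, terminate and declare the problem infeasible. Otherwise take its solution $(x,\theta)$ and solve the Benders subproblems at $x$ by the inner loop. For every $(s,j)$ whose Benders subproblem admits an optimal solution, augment $\mathcal U^0_{sj}$ with an optimal extreme point of the dual; for every other $(s,j)$, augment $\mathcal V^0_{sj}$ with an extreme ray defining a direction of unboundedness of the dual. If no cut is violated by $(x,\theta)$, terminate with $x^*=x$ and the associated second-stage solution as the solution of $(\mathrm{MIO\text{-}LO})$; otherwise solve the master problem again. *Inner loop (column generation).* Maintain restricted arc sets $\mathcal A'_{sj}\subseteq\mathcal A_{sj}$.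 Solve the Benders subproblem with $\mathcal A_{sj}$ replaced by $\mathcal A'_{sj}$, with dual solution $(\psi,\gamma)$, and solve for each $s,j$ the pricing problem $$RC=\min\{g_{(m,n)}-(\psi_{sjm}-\psi_{sjn})-\gamma_{sj}^\top f_{(m,n),s,j}:(m,n)\in\mathcal A_{sj}\}.$$ If $RC<0$, add the corresponding arc to $\mathcal A'_{sj}$ and repeat; if $RC\ge0$ for all $s,j$, stop. *Upon termination of the outer loop,* the second-stage problem with integrality requirements is solved at $x^*$ to derive a feasible solution of $(\star)$; its total cost is $c^\top x^*$ plus its second-stage cost.
   Formalization: Assumes each dual region P_sj is nonempty and each feasible master met has an optimum; extreme points/rays are modulo the lineality space, plus ± a basis of it; infeasible restricted subproblems use Farkas pricing; no upper bound if the integer second stage at x* has no optimum. *)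

theory Defs
  imports "HOL-Analysis.Analysis"
begin

section \<open>Extreme points and extreme rays\<close>

definition recession_cone :: "'a::real_vector set \<Rightarrow> 'a set" where
  "recession_cone P = {d. \<forall>z\<in>P. \<forall>t\<ge>0. z + t *\<^sub>R d \<in> P}"

definition lineality_space :: "'a::real_vector set \<Rightarrow> 'a set" where
  "lineality_space P = {d. d \<in> recession_cone P \<and> - d \<in> recession_cone P}"

text \<open>
  The dual polyhedron of a network flow problem is never pointed when there is a node: adding a
  constant to the node potentials leaves all potential differences unchanged. Extreme points and
  extreme rays are therefore understood modulo the lineality space \<open>L\<close>, i.e. as those of the image
  of the polyhedron in the quotient by \<open>L\<close>. If \<open>L = {0}\<close>, these are the ordinary notions
  (see \<open>extreme_point_mod_iff\<close> below).
\<close>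

definition extreme_point_mod :: "'a::real_vector set \<Rightarrow> 'a \<Rightarrow> bool" where
  "extreme_point_mod P z \<longleftrightarrow> z \<in> P \<and>
     (\<forall>a\<in>P. \<forall>b\<in>P. z \<in> open_segment a b \<longrightarrow> a - b \<in> lineality_space P)"

definition extreme_ray_mod :: "'a::real_vector set \<Rightarrow> 'a \<Rightarrow> bool" where
  "extreme_ray_mod P r \<longleftrightarrow> r \<in> recession_cone P \<and> r \<notin> lineality_space P \<and>
     (\<forall>a\<in>recession_cone P. \<forall>b\<in>recession_cone P. r = a + b \<longrightarrow>
        (\<exists>t\<ge>0. a - t *\<^sub>R r \<in> lineality_space P))"

lemma extreme_point_mod_iff:
  assumes "lineality_space P = {0}"
  shows "extreme_point_mod P z \<longleftrightarrow> z extreme_point_of P"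
proof -
  have "z \<in> open_segment a b \<Longrightarrow> a \<noteq> b" for a b :: 'a
    by auto
  then show ?thesis
    using assms unfolding extreme_point_mod_def extreme_point_of_def by auto
qed

text \<open>
  Any choice of one representative per extreme point, resp. per extreme ray (up to positive
  scaling), is admitted. The directions in \<open>L\<close> itself, along which a linear objective can be
  unbounded as well, are represented by the vectors of a basis of \<open>L\<close> and their negatives.
  For \<open>L = {0}\<close>, the first definition says that \<open>U\<close> is the set of extreme points of \<open>P\<close>.
\<close>

definition enumerates_extreme_points :: "'a::real_vector set \<Rightarrow> 'a set \<Rightarrow> bool" where
  "enumerates_extreme_points P U \<longleftrightarrow>
     (\<forall>u\<in>U. extreme_point_mod P u) \<and>
     (\<forall>z. extreme_point_mod P z \<longrightarrow> (\<exists>!u. u \<in> U \<and> z - u \<in> lineality_space P))"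

definition enumerates_extreme_rays :: "'a::real_vector set \<Rightarrow> 'a set \<Rightarrow> bool" where
  "enumerates_extreme_rays P V \<longleftrightarrow>
     (\<forall>v\<in>V - lineality_space P. extreme_ray_mod P v) \<and>
     (\<forall>r. extreme_ray_mod P r \<longrightarrow>
        (\<exists>!v. v \<in> V - lineality_space P \<and> (\<exists>t>0. v - t *\<^sub>R r \<in> lineality_space P))) \<and>
     (\<exists>B. independent B \<and> span B = lineality_space P \<and>
        V \<inter> lineality_space P = B \<union> uminus ` B)"


section \<open>Problem data\<close>

text \<open>
  Scenarios \<open>'s\<close>, blocks \<open>'j\<close>, first-stage components \<open>'k\<close>, nodes \<open>'n\<close>, side-constraint rows \<open>'m\<close>,
  rows of the first-stage system \<open>'r\<close>. Each pair \<open>(s, j)\<close> has its own node set, arc set and set of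
  side-constraint rows; values outside these sets are irrelevant. Arcs of different pairs
  \<open>(s, j)\<close> are distinct, so all arc data carry the indices \<open>s\<close> and \<open>j\<close>.
\<close>

record ('s, 'j, 'k::finite, 'n::finite, 'm::finite, 'r::finite) dd_data =
  scen_prob :: "'s \<Rightarrow> real"
  blk :: "'j \<Rightarrow> 'k set"
  cost1 :: "real^'k"
  mat1 :: "real^'k^'r"
  rhs1 :: "real^'r"
  int_idx :: "'k set"
  nodes :: "'s \<Rightarrow> 'j \<Rightarrow> 'n set"
  arcs :: "'s \<Rightarrow> 'j \<Rightarrow> ('n \<times> 'n) set"
  ydom :: "'s \<Rightarrow> 'j \<Rightarrow> 'n \<times> 'n \<Rightarrow> real set"
  gcost :: "'s \<Rightarrow> 'j \<Rightarrow> 'n \<times> 'n \<Rightarrow> real"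
  bcoef :: "'n \<Rightarrow> 's \<Rightarrow> 'k \<Rightarrow> real"
  rows :: "'s \<Rightarrow> 'j \<Rightarrow> 'm set"
  fvec :: "'s \<Rightarrow> 'j \<Rightarrow> 'n \<times> 'n \<Rightarrow> real^'m"
  hvec :: "'s \<Rightarrow> 'j \<Rightarrow> real^'m"

text \<open>
  \<open>ydom \<subseteq> {0..}\<close> is what makes the replacement of the discrete domains by \<open>y \<ge> 0\<close> a relaxation.
\<close>

definition dd_instance ::
  "('s::finite, 'j::finite, 'k::finite, 'n::finite, 'm::finite, 'r::finite) dd_data \<Rightarrow> bool" where
  "dd_instance D \<longleftrightarrow>
     (\<forall>s. 0 \<le> scen_prob D s) \<and> (\<Sum>s\<in>UNIV. scen_prob D s) = 1 \<and>
     (\<Union>j. blk D j) = UNIV \<and> disjoint_family (blk D) \<and>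
     (\<forall>s j. arcs D s j \<subseteq> nodes D s j \<times> nodes D s j) \<and>
     (\<forall>s j. \<forall>a\<in>arcs D s j. ydom D s j a \<subseteq> {0..})"

definition first_stage :: "('s, 'j, 'k::finite, 'n::finite, 'm::finite, 'r::finite) dd_data \<Rightarrow>
    real^'k \<Rightarrow> bool" where
  "first_stage D x \<longleftrightarrow> rhs1 D \<le> mat1 D *v x \<and> (\<forall>k\<in>int_idx D. x $ k \<in> \<int>)"

definition first_cost :: "('s, 'j::finite, 'k::finite, 'n::finite, 'm::finite, 'r::finite) dd_data \<Rightarrow>
    real^'k \<Rightarrow> real" where
  "first_cost D x = (\<Sum>j\<in>UNIV. \<Sum>k\<in>blk D j. cost1 D $ k * x $ k)"

text \<open>
  In the following the arc set \<open>E\<close> is a parameter, as column generation works with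
  restricted arc sets. Flows are set to 0 outside \<open>E\<close>.
\<close>

definition flow_balance :: "('s, 'j, 'k::finite, 'n::finite, 'm::finite, 'r::finite) dd_data \<Rightarrow>
    's \<Rightarrow> 'j \<Rightarrow> ('n \<times> 'n) set \<Rightarrow> real^'k \<Rightarrow> ('n \<times> 'n \<Rightarrow> real) \<Rightarrow> bool" where
  "flow_balance D s j E x y \<longleftrightarrow> (\<forall>n\<in>nodes D s j.
     (\<Sum>m | (n, m) \<in> E. y (n, m)) - (\<Sum>m | (m, n) \<in> E. y (m, n))
       = (\<Sum>k\<in>blk D j. bcoef D n s k * x $ k))"

definition side_constraints :: "('s, 'j, 'k::finite, 'n::finite, 'm::finite, 'r::finite) dd_data \<Rightarrow>
    's \<Rightarrow> 'j \<Rightarrow> ('n \<times> 'n) set \<Rightarrow> ('n \<times> 'n \<Rightarrow> real) \<Rightarrow> bool" where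
  "side_constraints D s j E y \<longleftrightarrow>
     (\<forall>i\<in>rows D s j. (\<Sum>a\<in>E. fvec D s j a $ i * y a) \<ge> hvec D s j $ i)"

definition arc_cost :: "('s, 'j, 'k::finite, 'n::finite, 'm::finite, 'r::finite) dd_data \<Rightarrow>
    's \<Rightarrow> 'j \<Rightarrow> ('n \<times> 'n) set \<Rightarrow> ('n \<times> 'n \<Rightarrow> real) \<Rightarrow> real" where
  "arc_cost D s j E y = (\<Sum>a\<in>E. gcost D s j a * y a)"

definition second_cost ::
  "('s::finite, 'j::finite, 'k::finite, 'n::finite, 'm::finite, 'r::finite) dd_data \<Rightarrow>
    ('s \<Rightarrow> 'j \<Rightarrow> 'n \<times> 'n \<Rightarrow> real) \<Rightarrow> real" where
  "second_cost D y =
     (\<Sum>s\<in>UNIV. \<Sum>j\<in>UNIV. scen_prob D s * arc_cost D s j (arcs D s j) (y s j))"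

definition total_cost ::
  "('s::finite, 'j::finite, 'k::finite, 'n::finite, 'm::finite, 'r::finite) dd_data \<Rightarrow>
    (real^'k) \<times> ('s \<Rightarrow> 'j \<Rightarrow> 'n \<times> 'n \<Rightarrow> real) \<Rightarrow> real" where
  "total_cost D = (\<lambda>(x, y). first_cost D x + second_cost D y)"


section \<open>The problems\<close>

definition sub_feasible :: "('s, 'j, 'k::finite, 'n::finite, 'm::finite, 'r::finite) dd_data \<Rightarrow>
    's \<Rightarrow> 'j \<Rightarrow> ('n \<times> 'n) set \<Rightarrow> real^'k \<Rightarrow> ('n \<times> 'n \<Rightarrow> real) \<Rightarrow> bool" where
  "sub_feasible D s j E x y \<longleftrightarrow> flow_balance D s j E x y \<and> side_constraints D s j E y \<and>
     (\<forall>a\<in>E. 0 \<le> y a) \<and> (\<forall>a. a \<notin> E \<longrightarrow> y a = 0)"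

definition sub_optimal :: "('s, 'j, 'k::finite, 'n::finite, 'm::finite, 'r::finite) dd_data \<Rightarrow>
    's \<Rightarrow> 'j \<Rightarrow> ('n \<times> 'n) set \<Rightarrow> real^'k \<Rightarrow> ('n \<times> 'n \<Rightarrow> real) \<Rightarrow> bool" where
  "sub_optimal D s j E x y \<longleftrightarrow> is_arg_min (arc_cost D s j E) (sub_feasible D s j E x) y"

definition second_feasible :: "('s, 'j, 'k::finite, 'n::finite, 'm::finite, 'r::finite) dd_data \<Rightarrow>
    real^'k \<Rightarrow> ('s \<Rightarrow> 'j \<Rightarrow> 'n \<times> 'n \<Rightarrow> real) \<Rightarrow> bool" where
  "second_feasible D x y \<longleftrightarrow> (\<forall>s j.
     flow_balance D s j (arcs D s j) x (y s j) \<and> side_constraints D s j (arcs D s j) (y s j) \<and>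
     (\<forall>a\<in>arcs D s j. y s j a \<in> ydom D s j a) \<and> (\<forall>a. a \<notin> arcs D s j \<longrightarrow> y s j a = 0))"

definition second_optimal ::
  "('s::finite, 'j::finite, 'k::finite, 'n::finite, 'm::finite, 'r::finite) dd_data \<Rightarrow>
    real^'k \<Rightarrow> ('s \<Rightarrow> 'j \<Rightarrow> 'n \<times> 'n \<Rightarrow> real) \<Rightarrow> bool" where
  "second_optimal D x y \<longleftrightarrow> is_arg_min (second_cost D) (second_feasible D x) y"

definition star_feasible :: "('s, 'j, 'k::finite, 'n::finite, 'm::finite, 'r::finite) dd_data \<Rightarrow>
    (real^'k) \<times> ('s \<Rightarrow> 'j \<Rightarrow> 'n \<times> 'n \<Rightarrow> real) \<Rightarrow> bool" where
  "star_feasible D = (\<lambda>(x, y). first_stage D x \<and> second_feasible D x y)"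

definition miolo_feasible :: "('s, 'j, 'k::finite, 'n::finite, 'm::finite, 'r::finite) dd_data \<Rightarrow>
    (real^'k) \<times> ('s \<Rightarrow> 'j \<Rightarrow> 'n \<times> 'n \<Rightarrow> real) \<Rightarrow> bool" where
  "miolo_feasible D = (\<lambda>(x, y).
     first_stage D x \<and> (\<forall>s j. sub_feasible D s j (arcs D s j) x (y s j)))"

definition star_value ::
  "('s::finite, 'j::finite, 'k::finite, 'n::finite, 'm::finite, 'r::finite) dd_data \<Rightarrow> ereal" where
  "star_value D = (INF p\<in>{p. star_feasible D p}. ereal (total_cost D p))"

definition miolo_value ::
  "('s::finite, 'j::finite, 'k::finite, 'n::finite, 'm::finite, 'r::finite) dd_data \<Rightarrow> ereal" where
  "miolo_value D = (INF p\<in>{p. miolo_feasible D p}. ereal (total_cost D p))"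

definition miolo_optimal ::
  "('s::finite, 'j::finite, 'k::finite, 'n::finite, 'm::finite, 'r::finite) dd_data \<Rightarrow>
    (real^'k) \<times> ('s \<Rightarrow> 'j \<Rightarrow> 'n \<times> 'n \<Rightarrow> real) \<Rightarrow> bool" where
  "miolo_optimal D p \<longleftrightarrow> is_arg_min (total_cost D) (miolo_feasible D) p"


section \<open>Dual subproblems and master problem\<close>

text \<open>Components of \<open>\<psi>\<close> and \<open>\<gamma>\<close> without a corresponding node or row are set to 0.\<close>

definition dual_poly :: "('s, 'j, 'k::finite, 'n::finite, 'm::finite, 'r::finite) dd_data \<Rightarrow>
    's \<Rightarrow> 'j \<Rightarrow> ('n \<times> 'n) set \<Rightarrow> ((real^'n) \<times> (real^'m)) set" where
  "dual_poly D s j E = {(\<psi>, \<gamma>).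
     (\<forall>n. n \<notin> nodes D s j \<longrightarrow> \<psi> $ n = 0) \<and> (\<forall>i. i \<notin> rows D s j \<longrightarrow> \<gamma> $ i = 0) \<and>
     (\<forall>i\<in>rows D s j. 0 \<le> \<gamma> $ i) \<and>
     (\<forall>(m, n)\<in>E. \<psi> $ m - \<psi> $ n + \<gamma> \<bullet> fvec D s j (m, n) \<le> gcost D s j (m, n))}"

definition dual_obj :: "('s, 'j, 'k::finite, 'n::finite, 'm::finite, 'r::finite) dd_data \<Rightarrow>
    's \<Rightarrow> 'j \<Rightarrow> real^'k \<Rightarrow> (real^'n) \<times> (real^'m) \<Rightarrow> real" where
  "dual_obj D s j x = (\<lambda>(\<psi>, \<gamma>).
     (\<Sum>n\<in>nodes D s j. \<Sum>k\<in>blk D j. bcoef D n s k * x $ k * \<psi> $ n) + hvec D s j \<bullet> \<gamma>)"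

definition dual_optimal :: "('s, 'j, 'k::finite, 'n::finite, 'm::finite, 'r::finite) dd_data \<Rightarrow>
    's \<Rightarrow> 'j \<Rightarrow> ('n \<times> 'n) set \<Rightarrow> real^'k \<Rightarrow> (real^'n) \<times> (real^'m) \<Rightarrow> bool" where
  "dual_optimal D s j E x z \<longleftrightarrow> is_arg_max (dual_obj D s j x) (\<lambda>z. z \<in> dual_poly D s j E) z"

definition cuts_hold :: "('s, 'j, 'k::finite, 'n::finite, 'm::finite, 'r::finite) dd_data \<Rightarrow>
    ('s \<Rightarrow> 'j \<Rightarrow> ((real^'n) \<times> (real^'m)) set) \<Rightarrow> ('s \<Rightarrow> 'j \<Rightarrow> ((real^'n) \<times> (real^'m)) set) \<Rightarrow>
    real^'k \<Rightarrow> ('s \<Rightarrow> 'j \<Rightarrow> real) \<Rightarrow> bool" where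
  "cuts_hold D Uc Vc x \<theta> \<longleftrightarrow> (\<forall>s j.
     (\<forall>u\<in>Uc s j. \<theta> s j \<ge> dual_obj D s j x u) \<and> (\<forall>v\<in>Vc s j. 0 \<ge> dual_obj D s j x v))"

definition master_feasible :: "('s, 'j, 'k::finite, 'n::finite, 'm::finite, 'r::finite) dd_data \<Rightarrow>
    ('s \<Rightarrow> 'j \<Rightarrow> ((real^'n) \<times> (real^'m)) set) \<Rightarrow> ('s \<Rightarrow> 'j \<Rightarrow> ((real^'n) \<times> (real^'m)) set) \<Rightarrow>
    (real^'k) \<times> ('s \<Rightarrow> 'j \<Rightarrow> real) \<Rightarrow> bool" where
  "master_feasible D Uc Vc = (\<lambda>(x, \<theta>). first_stage D x \<and> cuts_hold D Uc Vc x \<theta>)"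

definition master_cost ::
  "('s::finite, 'j::finite, 'k::finite, 'n::finite, 'm::finite, 'r::finite) dd_data \<Rightarrow>
    (real^'k) \<times> ('s \<Rightarrow> 'j \<Rightarrow> real) \<Rightarrow> real" where
  "master_cost D = (\<lambda>(x, \<theta>). first_cost D x + (\<Sum>s\<in>UNIV. \<Sum>j\<in>UNIV. scen_prob D s * \<theta> s j))"

definition master_optimal ::
  "('s::finite, 'j::finite, 'k::finite, 'n::finite, 'm::finite, 'r::finite) dd_data \<Rightarrow>
    ('s \<Rightarrow> 'j \<Rightarrow> ((real^'n) \<times> (real^'m)) set) \<Rightarrow> ('s \<Rightarrow> 'j \<Rightarrow> ((real^'n) \<times> (real^'m)) set) \<Rightarrow>
    (real^'k) \<times> ('s \<Rightarrow> 'j \<Rightarrow> real) \<Rightarrow> bool" where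
  "master_optimal D Uc Vc p \<longleftrightarrow> is_arg_min (master_cost D) (master_feasible D Uc Vc) p"


section \<open>The algorithm\<close>

text \<open>
  The reduced cost with respect to an arc cost function \<open>w\<close>, which is \<open>gcost D s j\<close> in the regular
  pricing problem and 0 when pricing with a direction of unboundedness (see below).
\<close>

definition reduced_cost :: "('s, 'j, 'k::finite, 'n::finite, 'm::finite, 'r::finite) dd_data \<Rightarrow>
    's \<Rightarrow> 'j \<Rightarrow> ('n \<times> 'n \<Rightarrow> real) \<Rightarrow> (real^'n) \<times> (real^'m) \<Rightarrow> 'n \<times> 'n \<Rightarrow> real" where
  "reduced_cost D s j w = (\<lambda>(\<psi>, \<gamma>) (m, n).
     w (m, n) - (\<psi> $ m - \<psi> $ n) - \<gamma> \<bullet> fvec D s j (m, n))"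

text \<open>
  Outcome of solving the subproblem over \<open>E\<close>: either an optimal dual solution \<open>z\<close>, priced with the
  arc costs, or, if the restricted subproblem is infeasible, a direction of unboundedness \<open>z\<close> of its
  dual, priced with zero costs (Farkas pricing).
\<close>

definition priced_dual :: "('s, 'j, 'k::finite, 'n::finite, 'm::finite, 'r::finite) dd_data \<Rightarrow>
    's \<Rightarrow> 'j \<Rightarrow> ('n \<times> 'n) set \<Rightarrow> real^'k \<Rightarrow> ('n \<times> 'n \<Rightarrow> real) \<Rightarrow> (real^'n) \<times> (real^'m) \<Rightarrow> bool" where
  "priced_dual D s j E x w z \<longleftrightarrow>
     (\<exists>y. sub_optimal D s j E x y) \<and> w = gcost D s j \<and> dual_optimal D s j E x z \<or>
     (\<nexists>y. sub_feasible D s j E x y) \<and> w = (\<lambda>_. 0) \<and>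
       z \<in> recession_cone (dual_poly D s j E) \<and> 0 < dual_obj D s j x z"

definition prices_out :: "('s, 'j, 'k::finite, 'n::finite, 'm::finite, 'r::finite) dd_data \<Rightarrow>
    's \<Rightarrow> 'j \<Rightarrow> ('n \<times> 'n \<Rightarrow> real) \<Rightarrow> (real^'n) \<times> (real^'m) \<Rightarrow> bool" where
  "prices_out D s j w z \<longleftrightarrow> (\<forall>a\<in>arcs D s j. 0 \<le> reduced_cost D s j w z a)"

definition pricing_update :: "('s, 'j, 'k::finite, 'n::finite, 'm::finite, 'r::finite) dd_data \<Rightarrow>
    's \<Rightarrow> 'j \<Rightarrow> ('n \<times> 'n \<Rightarrow> real) \<Rightarrow> (real^'n) \<times> (real^'m) \<Rightarrow>
    ('n \<times> 'n) set \<Rightarrow> ('n \<times> 'n) set \<Rightarrow> bool" where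
  "pricing_update D s j w z E E' \<longleftrightarrow>
     (if prices_out D s j w z then E' = E
      else \<exists>a. is_arg_min (reduced_cost D s j w z) (\<lambda>a. a \<in> arcs D s j) a \<and> E' = insert a E)"

definition cut_update :: "('s, 'j, 'k::finite, 'n::finite, 'm::finite, 'r::finite) dd_data \<Rightarrow>
    's \<Rightarrow> 'j \<Rightarrow> ((real^'n) \<times> (real^'m)) set \<Rightarrow> ((real^'n) \<times> (real^'m)) set \<Rightarrow> real^'k \<Rightarrow>
    ((real^'n) \<times> (real^'m)) set \<Rightarrow> ((real^'n) \<times> (real^'m)) set \<Rightarrow>
    ((real^'n) \<times> (real^'m)) set \<Rightarrow> ((real^'n) \<times> (real^'m)) set \<Rightarrow> bool" where
  "cut_update D s j U V x Uc Vc Uc' Vc' \<longleftrightarrow>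
     (if \<exists>y. sub_optimal D s j (arcs D s j) x y
      then (\<exists>u\<in>U. dual_optimal D s j (arcs D s j) x u \<and> Uc' = insert u Uc \<and> Vc' = Vc)
      else (\<exists>v\<in>V. 0 < dual_obj D s j x v \<and> Uc' = Uc \<and> Vc' = insert v Vc))"

text \<open>
  \<open>Master Uc Vc E\<close>: about to solve the master problem with the cuts \<open>Uc\<close>, \<open>Vc\<close>;
  \<open>Inner Uc Vc E x \<theta>\<close>: column generation at the master solution \<open>(x, \<theta>)\<close> with arc sets \<open>E\<close>;
  \<open>Terminated x y\<close>: the outer loop has stopped with the solution \<open>(x, y)\<close>;
  \<open>Returned x y y'\<close>: in addition, the second-stage problem with integrality requirements has been
  solved at \<open>x\<close>, with solution \<open>y'\<close>.
\<close>

datatype ('s, 'j, 'k::finite, 'n::finite, 'm::finite) dd_state =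
    Master "'s \<Rightarrow> 'j \<Rightarrow> ((real^'n) \<times> (real^'m)) set" "'s \<Rightarrow> 'j \<Rightarrow> ((real^'n) \<times> (real^'m)) set"
      "'s \<Rightarrow> 'j \<Rightarrow> ('n \<times> 'n) set"
  | Inner "'s \<Rightarrow> 'j \<Rightarrow> ((real^'n) \<times> (real^'m)) set" "'s \<Rightarrow> 'j \<Rightarrow> ((real^'n) \<times> (real^'m)) set"
      "'s \<Rightarrow> 'j \<Rightarrow> ('n \<times> 'n) set" "real^'k" "'s \<Rightarrow> 'j \<Rightarrow> real"
  | Infeasible
  | Terminated "real^'k" "'s \<Rightarrow> 'j \<Rightarrow> 'n \<times> 'n \<Rightarrow> real"
  | Returned "real^'k" "'s \<Rightarrow> 'j \<Rightarrow> 'n \<times> 'n \<Rightarrow> real" "'s \<Rightarrow> 'j \<Rightarrow> 'n \<times> 'n \<Rightarrow> real"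

inductive dd_step ::
  "('s::finite, 'j::finite, 'k::finite, 'n::finite, 'm::finite, 'r::finite) dd_data \<Rightarrow>
    ('s \<Rightarrow> 'j \<Rightarrow> ((real^'n) \<times> (real^'m)) set) \<Rightarrow> ('s \<Rightarrow> 'j \<Rightarrow> ((real^'n) \<times> (real^'m)) set) \<Rightarrow>
    ('s, 'j, 'k, 'n, 'm) dd_state \<Rightarrow> ('s, 'j, 'k, 'n, 'm) dd_state \<Rightarrow> bool"
  for D U V where
  master_infeasible:
    "\<nexists>p. master_feasible D Uc Vc p \<Longrightarrow> dd_step D U V (Master Uc Vc E) Infeasible"
| master_solve:
    "master_optimal D Uc Vc (x, \<theta>) \<Longrightarrow> dd_step D U V (Master Uc Vc E) (Inner Uc Vc E x \<theta>)"
| price: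
    "\<lbrakk>\<forall>s j. priced_dual D s j (E s j) x (w s j) (z s j);
      \<exists>s j. \<not> prices_out D s j (w s j) (z s j);
      \<forall>s j. pricing_update D s j (w s j) (z s j) (E s j) (E' s j)\<rbrakk> \<Longrightarrow>
     dd_step D U V (Inner Uc Vc E x \<theta>) (Inner Uc Vc E' x \<theta>)"
| add_cuts:
    "\<lbrakk>\<forall>s j. priced_dual D s j (E s j) x (w s j) (z s j);
      \<forall>s j. prices_out D s j (w s j) (z s j);
      \<forall>s j. cut_update D s j (U s j) (V s j) x (Uc s j) (Vc s j) (Uc' s j) (Vc' s j);
      \<not> cuts_hold D Uc' Vc' x \<theta>\<rbrakk> \<Longrightarrow>
     dd_step D U V (Inner Uc Vc E x \<theta>) (Master Uc' Vc' E)"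
| terminate:
    "\<lbrakk>\<forall>s j. priced_dual D s j (E s j) x (w s j) (z s j);
      \<forall>s j. prices_out D s j (w s j) (z s j);
      \<forall>s j. cut_update D s j (U s j) (V s j) x (Uc s j) (Vc s j) (Uc' s j) (Vc' s j);
      cuts_hold D Uc' Vc' x \<theta>;
      \<forall>s j. sub_optimal D s j (E s j) x (y s j)\<rbrakk> \<Longrightarrow>
     dd_step D U V (Inner Uc Vc E x \<theta>) (Terminated x y)"
| integer_second_stage:
    "second_optimal D x y' \<Longrightarrow> dd_step D U V (Terminated x y) (Returned x y y')"

end

theory Submission
  imports Defs
begin

text \<open>
  Correctness rests on linear programming duality for the subproblems. The dual polyhedron is given by
  finitely many linear inequalities, and everything about it is derived from the sets of constraints
  that are tight at its points. Two extreme points with the same tight constraints agree modulo the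
  lineality space, and likewise for extreme rays up to scaling, so there are finitely many cuts
  (\<open>finite_extreme_points\<close>, \<open>finite_extreme_rays\<close>). A point with a maximal tight set among those that are
  at least as good as a given one is extreme, which gives optimal extreme points
  (\<open>extreme_point_optimal\<close>); the same argument in the recession cone gives extreme rays of unboundedness
  (\<open>extreme_ray_improving\<close>). At a dual optimum, the objective lies in the cone generated by the tight
  normals (\<open>optimal_in_tight_cone\<close>), and the multipliers form a flow of the same cost
  (\<open>strong_duality\<close>).

  Column generation stops with a dual solution feasible for all arcs; hence a flow that is optimal on
  the restricted arc set is optimal for the whole subproblem (\<open>priced_out_optimal\<close>). All cuts are valid,
  so the master problem is a relaxation of the problem with continuous second stage
  (\<open>master_relaxation\<close>). When no cut is violated, every \<open>\<theta>\<close> component is at least the cost of the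
  subproblem, so the master value bounds the cost of the current solution from above and the optimal
  value from below (\<open>termination_optimal\<close>).

  A run is finite because each pricing step generates a new arc for some subproblem, whereas each return
  to the master problem generates a new cut: the master solution satisfies all old cuts, so the violated
  one is new (\<open>step_decreases\<close>). A run can only stop as described since strong duality provides an outcome
  of every subproblem and the enumerated points and rays provide a cut (\<open>inner_progress\<close>).
\<close>


section \<open>Polyhedra given by finitely many inequalities\<close>

text \<open>
  The polyhedron of a system of inequalities, each a pair of a normal vector and a right-hand side.
\<close>

definition ineq_set :: "('e::euclidean_space \<times> real) set \<Rightarrow> 'e set" where
  "ineq_set K = {z. \<forall>(a, \<beta>)\<in>K. a \<bullet> z \<le> \<beta>}"

text \<open>The constraints of the system that hold with equality at \<open>z\<close>.\<close>

definition tight :: "('e::euclidean_space \<times> real) set \<Rightarrow> 'e \<Rightarrow> ('e \<times> real) set" where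
  "tight K z = {(a, \<beta>)\<in>K. a \<bullet> z = \<beta>}"

lemma ineq_setI: "(\<And>a \<beta>. (a, \<beta>) \<in> K \<Longrightarrow> a \<bullet> z \<le> \<beta>) \<Longrightarrow> z \<in> ineq_set K"
  by (auto simp: ineq_set_def)

lemma ineq_setD: "z \<in> ineq_set K \<Longrightarrow> (a, \<beta>) \<in> K \<Longrightarrow> a \<bullet> z \<le> \<beta>"
  by (auto simp: ineq_set_def)

lemma tight_iff: "(a, \<beta>) \<in> tight K z \<longleftrightarrow> (a, \<beta>) \<in> K \<and> a \<bullet> z = \<beta>"
  by (auto simp: tight_def)

lemma tight_subset: "tight K z \<subseteq> K"
  by (auto simp: tight_def)

lemma recession_cone_ineq_set:
  assumes "ineq_set K \<noteq> {}"
  shows "recession_cone (ineq_set K) = {d. \<forall>(a, \<beta>)\<in>K. a \<bullet> d \<le> 0}"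
proof (intro equalityI subsetI CollectI)
  fix d assume d: "d \<in> recession_cone (ineq_set K)"
  obtain z where z: "z \<in> ineq_set K" using assms by auto
  have "a \<bullet> d \<le> 0" if K: "(a, \<beta>) \<in> K" for a \<beta>
  proof (rule ccontr)
    assume "\<not> a \<bullet> d \<le> 0"
    then have pos: "a \<bullet> d > 0" by simp
    define t where "t = (\<beta> - a \<bullet> z + 1) / (a \<bullet> d)"
    have "a \<bullet> z \<le> \<beta>" using z K by (rule ineq_setD)
    then have "t \<ge> 0" using pos by (simp add: t_def)
    then have "z + t *\<^sub>R d \<in> ineq_set K"
      using d z by (auto simp: recession_cone_def)
    then have "a \<bullet> (z + t *\<^sub>R d) \<le> \<beta>" using K by (rule ineq_setD)
    moreover have "t * (a \<bullet> d) = \<beta> - a \<bullet> z + 1" using pos by (simp add: t_def)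
    ultimately show False by (simp add: inner_simps)
  qed
  then show "\<forall>(a, \<beta>)\<in>K. a \<bullet> d \<le> 0" by auto
next
  fix d assume "d \<in> {d. \<forall>(a, \<beta>)\<in>K. a \<bullet> d \<le> 0}"
  then have d: "a \<bullet> d \<le> 0" if "(a, \<beta>) \<in> K" for a \<beta> using that by auto
  have "z + t *\<^sub>R d \<in> ineq_set K" if "z \<in> ineq_set K" "t \<ge> 0" for z t
  proof (rule ineq_setI)
    fix a \<beta> assume K: "(a, \<beta>) \<in> K"
    have "t * (a \<bullet> d) \<le> 0" using d[OF K] that by (simp add: mult_nonneg_nonpos)
    then show "a \<bullet> (z + t *\<^sub>R d) \<le> \<beta>" using ineq_setD[OF that(1) K] by (simp add: inner_simps)
  qed
  then show "d \<in> recession_cone (ineq_set K)" by (auto simp: recession_cone_def)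
qed

lemma lineality_space_ineq_set:
  assumes "ineq_set K \<noteq> {}"
  shows "lineality_space (ineq_set K) = {d. \<forall>(a, \<beta>)\<in>K. a \<bullet> d = 0}"
proof (intro set_eqI)
  fix d
  show "d \<in> lineality_space (ineq_set K) \<longleftrightarrow> d \<in> {d. \<forall>(a, \<beta>)\<in>K. a \<bullet> d = 0}"
    unfolding lineality_space_def recession_cone_ineq_set[OF assms] mem_Collect_eq inner_minus_right
      neg_le_0_iff_le case_prod_unfold by (metis order_antisym order_refl)
qed

text \<open>Along a direction that no tight constraint opposes, there is room for a positive step.\<close>

lemma feasible_step:
  assumes "finite K" "z \<in> ineq_set K" "\<And>a \<beta>. (a, \<beta>) \<in> tight K z \<Longrightarrow> a \<bullet> d \<le> 0"
  obtains \<epsilon> where "\<epsilon> > 0" "\<And>t. 0 \<le> t \<Longrightarrow> t \<le> \<epsilon> \<Longrightarrow> z + t *\<^sub>R d \<in> ineq_set K"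
proof -
  define S where "S = {k \<in> K. fst k \<bullet> d > 0}"
  define \<epsilon> where "\<epsilon> = Min (insert 1 ((\<lambda>k. (snd k - fst k \<bullet> z) / (fst k \<bullet> d)) ` S))"
  have fin: "finite S" using assms(1) by (simp add: S_def)
  have slack: "fst k \<bullet> z < snd k" if "k \<in> S" for k
  proof (cases k)
    case (Pair a \<beta>)
    then have "(a, \<beta>) \<in> K" "a \<bullet> d > 0" using that by (auto simp: S_def)
    then show ?thesis using assms(3)[of a \<beta>] ineq_setD[OF assms(2)] Pair
      by (fastforce simp: tight_iff)
  qed
  have "\<epsilon> > 0"
    unfolding \<epsilon>_def using fin slack by (subst Min_gr_iff) (auto simp: S_def)
  moreover have "z + t *\<^sub>R d \<in> ineq_set K" if t: "0 \<le> t" "t \<le> \<epsilon>" for t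
  proof (rule ineq_setI)
    fix a \<beta> assume K: "(a, \<beta>) \<in> K"
    show "a \<bullet> (z + t *\<^sub>R d) \<le> \<beta>"
    proof (cases "a \<bullet> d > 0")
      case True
      then have S: "(a, \<beta>) \<in> S" using K by (simp add: S_def)
      then have "(\<beta> - a \<bullet> z) / (a \<bullet> d) \<in>
          insert 1 ((\<lambda>k. (snd k - fst k \<bullet> z) / (fst k \<bullet> d)) ` S)" by force
      then have "\<epsilon> \<le> (\<beta> - a \<bullet> z) / (a \<bullet> d)"
        unfolding \<epsilon>_def using fin by (intro Min_le) auto
      then have "t \<le> (\<beta> - a \<bullet> z) / (a \<bullet> d)" using t by simp
      then show ?thesis using True by (simp add: field_simps inner_simps)
    next
      case False
      then have "t * (a \<bullet> d) \<le> 0" using t by (simp add: mult_nonneg_nonpos)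
      then show ?thesis using ineq_setD[OF assms(2) K] by (simp add: inner_simps)
    qed
  qed
  ultimately show thesis by (rule that)
qed

text \<open>
  Moving along a direction that preserves the tight constraints and is eventually blocked leads to a
  point with strictly more tight constraints (the ratio test).
\<close>

lemma blocked_step:
  assumes "finite K" "z \<in> ineq_set K" "\<And>a \<beta>. (a, \<beta>) \<in> tight K z \<Longrightarrow> a \<bullet> d = 0"
    and "(a0, \<beta>0) \<in> K" "a0 \<bullet> d > 0"
  shows "\<exists>t\<ge>0. z + t *\<^sub>R d \<in> ineq_set K \<and> tight K z \<subset> tight K (z + t *\<^sub>R d)"
proof -
  define S where "S = {k \<in> K. fst k \<bullet> d > 0}"
  define t where "t = Min ((\<lambda>k. (snd k - fst k \<bullet> z) / (fst k \<bullet> d)) ` S)"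
  have fin: "finite S" using assms(1) by (simp add: S_def)
  have ne: "S \<noteq> {}" using assms(4,5) by (force simp: S_def)
  have "t \<in> (\<lambda>k. (snd k - fst k \<bullet> z) / (fst k \<bullet> d)) ` S"
    unfolding t_def using fin ne by (intro Min_in) auto
  then obtain a \<beta> where S: "(a, \<beta>) \<in> S" and t: "t = (\<beta> - a \<bullet> z) / (a \<bullet> d)" by force
  have K: "(a, \<beta>) \<in> K" and pos: "a \<bullet> d > 0" using S by (auto simp: S_def)
  have t0: "t \<ge> 0" using ineq_setD[OF assms(2) K] pos by (simp add: t)
  have "z + t *\<^sub>R d \<in> ineq_set K"
  proof (rule ineq_setI)
    fix a' \<beta>' assume K': "(a', \<beta>') \<in> K"
    show "a' \<bullet> (z + t *\<^sub>R d) \<le> \<beta>'"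
    proof (cases "a' \<bullet> d > 0")
      case True
      then have "(a', \<beta>') \<in> S" using K' by (simp add: S_def)
      then have "t \<le> (\<beta>' - a' \<bullet> z) / (a' \<bullet> d)"
        unfolding t_def using fin by (intro Min_le) force+
      then show ?thesis using True by (simp add: field_simps inner_simps)
    next
      case False
      then have "t * (a' \<bullet> d) \<le> 0" using t0 by (simp add: mult_nonneg_nonpos)
      then show ?thesis using ineq_setD[OF assms(2) K'] by (simp add: inner_simps)
    qed
  qed
  moreover have "tight K z \<subseteq> tight K (z + t *\<^sub>R d)"
    using assms(3) by (auto simp: tight_def inner_simps)
  moreover have "(a, \<beta>) \<in> tight K (z + t *\<^sub>R d)"
    using K pos by (simp add: tight_iff inner_simps t)
  moreover have "(a, \<beta>) \<notin> tight K z" using assms(3)[of a \<beta>] pos by auto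
  ultimately show ?thesis using t0 by blast
qed

text \<open>
  Among the points with a property \<open>Q\<close>, one with an inclusion-maximal set of tight constraints stands in
  for a vertex in what follows: a blocked step from it must violate \<open>Q\<close>.
\<close>

lemma max_tight_exists:
  assumes "finite K" "Q z"
  shows "\<exists>u. Q u \<and> (\<forall>u'. Q u' \<longrightarrow> \<not> tight K u \<subset> tight K u')"
proof -
  have fin: "finite (tight K u)" for u using assms(1) tight_subset finite_subset by blast
  have "\<exists>u. Q u \<and> (\<forall>u'. Q u' \<longrightarrow> card (tight K u') \<le> card (tight K u))"
    using ex_has_greatest_nat[of Q z "\<lambda>u. card (tight K u)" "Suc (card K)"] assms
    by (auto simp: card_mono tight_subset less_Suc_eq_le)
  then show ?thesis using psubset_card_mono[OF fin] by (metis leD)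
qed


section \<open>Extreme points and extreme rays carry the linear optimization problem\<close>

text \<open>
  A point is extreme modulo the lineality space iff the directions orthogonal to its tight normals all
  lie in that space; the next two lemmas are the two directions of this.
\<close>

lemma extreme_point_modI:
  assumes "u \<in> ineq_set K"
    and "\<And>d. (\<And>a \<beta>. (a, \<beta>) \<in> tight K u \<Longrightarrow> a \<bullet> d = 0) \<Longrightarrow> d \<in> lineality_space (ineq_set K)"
  shows "extreme_point_mod (ineq_set K) u"
  unfolding extreme_point_mod_def
proof (intro conjI ballI impI)
  show "u \<in> ineq_set K" by fact
  fix p q assume p: "p \<in> ineq_set K" and q: "q \<in> ineq_set K" and "u \<in> open_segment p q"
  then obtain t where t: "0 < t" "t < 1" "u = (1 - t) *\<^sub>R p + t *\<^sub>R q"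
    by (auto simp: in_segment)
  show "p - q \<in> lineality_space (ineq_set K)"
  proof (rule assms(2))
    fix a \<beta> assume "(a, \<beta>) \<in> tight K u"
    then have K: "(a, \<beta>) \<in> K" and "a \<bullet> u = \<beta>" by (auto simp: tight_iff)
    then have eq: "(1 - t) * (\<beta> - a \<bullet> p) + t * (\<beta> - a \<bullet> q) = 0"
      using t by (simp add: inner_simps algebra_simps)
    have "(1 - t) * (\<beta> - a \<bullet> p) \<ge> 0" "t * (\<beta> - a \<bullet> q) \<ge> 0"
      using t ineq_setD[OF p K] ineq_setD[OF q K] by auto
    then have "(1 - t) * (\<beta> - a \<bullet> p) = 0" "t * (\<beta> - a \<bullet> q) = 0" using eq by linarith+
    then show "a \<bullet> (p - q) = 0" using t by (simp add: inner_simps)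
  qed
qed

lemma extreme_point_mod_tightD:
  assumes "finite K" "extreme_point_mod (ineq_set K) u"
    and "\<And>a \<beta>. (a, \<beta>) \<in> tight K u \<Longrightarrow> a \<bullet> d = 0"
  shows "d \<in> lineality_space (ineq_set K)"
proof (cases "d = 0")
  case True
  then show ?thesis by (simp add: lineality_space_def recession_cone_def)
next
  case False
  have u: "u \<in> ineq_set K" using assms(2) by (simp add: extreme_point_mod_def)
  then have ne: "ineq_set K \<noteq> {}" by auto
  obtain e1 where e1: "e1 > 0" "\<And>t. 0 \<le> t \<Longrightarrow> t \<le> e1 \<Longrightarrow> u + t *\<^sub>R d \<in> ineq_set K"
    using feasible_step[OF assms(1) u, of d] assms(3) by auto
  obtain e2 where e2: "e2 > 0" "\<And>t. 0 \<le> t \<Longrightarrow> t \<le> e2 \<Longrightarrow> u + t *\<^sub>R (- d) \<in> ineq_set K"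
    using feasible_step[OF assms(1) u, of "- d"] assms(3) by auto
  define e where "e = min e1 e2"
  have e: "e > 0" using e1 e2 by (simp add: e_def)
  have p: "u + e *\<^sub>R d \<in> ineq_set K" and q: "u + e *\<^sub>R (- d) \<in> ineq_set K"
    using e1(2)[of e] e2(2)[of e] e by (auto simp: e_def)
  have "u = (1 - 1/2) *\<^sub>R (u + e *\<^sub>R d) + (1/2) *\<^sub>R (u + e *\<^sub>R (- d))"
    by (simp add: algebra_simps flip: scaleR_left.add)
  moreover have "u + e *\<^sub>R d \<noteq> u + e *\<^sub>R (- d)"
    using e False by (simp add: eq_neg_iff_add_eq_0 flip: scaleR_left.add)
  ultimately have "u \<in> open_segment (u + e *\<^sub>R d) (u + e *\<^sub>R (- d))"
    unfolding in_segment by (intro conjI exI[of _ "1/2"]) simp_all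
  then have "(u + e *\<^sub>R d) - (u + e *\<^sub>R (- d)) \<in> lineality_space (ineq_set K)"
    using assms(2) p q unfolding extreme_point_mod_def by blast
  moreover have "(u + e *\<^sub>R d) - (u + e *\<^sub>R (- d)) = (2 * e) *\<^sub>R d"
    by (simp add: algebra_simps flip: scaleR_left.add)
  ultimately show ?thesis
    using e unfolding lineality_space_ineq_set[OF ne] by auto
qed

lemma extreme_point_dominates:
  assumes fin: "finite K" and z: "z \<in> ineq_set K"
    and c: "\<And>d. d \<in> recession_cone (ineq_set K) \<Longrightarrow> c \<bullet> d \<le> 0"
  obtains u where "extreme_point_mod (ineq_set K) u" "c \<bullet> z \<le> c \<bullet> u"
proof -
  have ne: "ineq_set K \<noteq> {}" using z by auto
  define Q where "Q u \<longleftrightarrow> u \<in> ineq_set K \<and> c \<bullet> z \<le> c \<bullet> u" for u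
  have "Q z" using z by (simp add: Q_def)
  then obtain u where "Q u" and max: "\<And>u'. Q u' \<Longrightarrow> \<not> tight K u \<subset> tight K u'"
    using max_tight_exists[OF fin, of Q] by blast
  then have u: "u \<in> ineq_set K" "c \<bullet> z \<le> c \<bullet> u" by (simp_all add: Q_def)
  \<comment> \<open>By maximality, no direction that keeps the tight constraints is blocked while \<open>c\<close> does not decrease.\<close>
  have unblocked: "d \<in> recession_cone (ineq_set K)"
    if d: "\<And>a \<beta>. (a, \<beta>) \<in> tight K u \<Longrightarrow> a \<bullet> d = 0" and "c \<bullet> d \<ge> 0" for d
  proof (rule ccontr)
    assume "d \<notin> recession_cone (ineq_set K)"
    then obtain a \<beta> where "(a, \<beta>) \<in> K" "a \<bullet> d > 0"
      unfolding recession_cone_ineq_set[OF ne] by force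
    then obtain t where t: "t \<ge> 0" "u + t *\<^sub>R d \<in> ineq_set K" "tight K u \<subset> tight K (u + t *\<^sub>R d)"
      using blocked_step[OF fin u(1), of d] d by blast
    have "c \<bullet> z \<le> c \<bullet> (u + t *\<^sub>R d)" using u(2) t(1) that(2)
      by (simp add: inner_simps add_increasing2)
    then show False using max t by (simp add: Q_def)
  qed
  have "extreme_point_mod (ineq_set K) u"
  proof (rule extreme_point_modI[OF u(1)])
    fix d assume d: "\<And>a \<beta>. (a, \<beta>) \<in> tight K u \<Longrightarrow> a \<bullet> d = 0"
    have d': "\<And>a \<beta>. (a, \<beta>) \<in> tight K u \<Longrightarrow> a \<bullet> (- d) = 0" using d by simp
    have "c \<bullet> d = 0"
      using unblocked[OF d] unblocked[OF d'] c[of d] c[of "- d"] by (fastforce simp: not_le)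
    then show "d \<in> lineality_space (ineq_set K)"
      using unblocked[OF d] unblocked[OF d'] by (simp add: lineality_space_def)
  qed
  then show thesis using u(2) by (rule that)
qed

text \<open>
  The supremum is attained because a linear function that vanishes on the lineality space takes only
  finitely many values on the extreme points.
\<close>

lemma extreme_point_optimal:
  assumes fin: "finite K" and ne: "ineq_set K \<noteq> {}"
    and c: "\<And>d. d \<in> recession_cone (ineq_set K) \<Longrightarrow> c \<bullet> d \<le> 0"
  shows "\<exists>u. extreme_point_mod (ineq_set K) u \<and> (\<forall>z\<in>ineq_set K. c \<bullet> z \<le> c \<bullet> u)"
proof -
  let ?X = "{u. extreme_point_mod (ineq_set K) u}"
  have c0: "c \<bullet> d = 0" if "d \<in> lineality_space (ineq_set K)" for d
    using c[of d] c[of "- d"] that by (auto simp: lineality_space_def)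
  have same: "c \<bullet> u = c \<bullet> u'" if "u \<in> ?X" "u' \<in> ?X" "tight K u = tight K u'" for u u'
  proof -
    have "a \<bullet> (u - u') = 0" if "(a, \<beta>) \<in> tight K u" for a \<beta>
      using that \<open>tight K u = tight K u'\<close> tight_iff by (metis inner_diff_right right_minus_eq)
    then have "u - u' \<in> lineality_space (ineq_set K)"
      using extreme_point_mod_tightD[OF fin, of u] that(1) by blast
    then show ?thesis using c0[of "u - u'"] by (simp add: inner_simps)
  qed
  have "finite (tight K ` ?X)"
    by (rule finite_subset[of _ "Pow K"]) (use fin tight_subset in auto)
  then obtain R where R: "R \<subseteq> ?X" "finite R" "tight K ` ?X = tight K ` R"
    by (meson finite_subset_image subset_refl)
  have dom: "\<exists>r\<in>R. c \<bullet> z \<le> c \<bullet> r" if z: "z \<in> ineq_set K" for z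
  proof -
    obtain u where u: "u \<in> ?X" "c \<bullet> z \<le> c \<bullet> u"
      using extreme_point_dominates[OF fin z c] by blast
    then obtain r where "r \<in> R" "tight K u = tight K r" using R(3) by blast
    moreover from this have "c \<bullet> u = c \<bullet> r" using same[of u r] u(1) R(1) by blast
    ultimately show ?thesis using u(2) by auto
  qed
  have "R \<noteq> {}" using dom ne by blast
  then have "Max ((\<bullet>) c ` R) \<in> (\<bullet>) c ` R" using R(2) by (intro Max_in) auto
  then obtain u where "u \<in> R" "c \<bullet> u = Max ((\<bullet>) c ` R)" by auto
  then have u: "u \<in> R" "\<And>r. r \<in> R \<Longrightarrow> c \<bullet> r \<le> c \<bullet> u"
    using R(2) by simp_all
  have "c \<bullet> z \<le> c \<bullet> u" if "z \<in> ineq_set K" for z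
    using dom[OF that] u(2) by force
  then show ?thesis using u(1) R(1) by blast
qed

text \<open>
  If \<open>c\<close> vanishes on the lineality space and is positive somewhere on the recession cone, then it is
  positive on an extreme ray, namely on an improving direction with a maximal tight set.
\<close>

lemma extreme_ray_improving:
  assumes fin: "finite K" and ne: "ineq_set K \<noteq> {}"
    and d: "d \<in> recession_cone (ineq_set K)" "c \<bullet> d > 0"
    and c: "\<And>l. l \<in> lineality_space (ineq_set K) \<Longrightarrow> c \<bullet> l = 0"
  obtains r where "extreme_ray_mod (ineq_set K) r" "c \<bullet> r > 0"
proof -
  \<comment> \<open>The recession cone is itself given by inequalities, with zero right-hand sides.\<close>
  define H where "H = (\<lambda>(a, \<beta>). (a, 0::real)) ` K"
  have finH: "finite H" using fin by (simp add: H_def)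
  have rec: "recession_cone (ineq_set K) = ineq_set H"
    unfolding recession_cone_ineq_set[OF ne] by (auto simp: ineq_set_def H_def)
  have lin: "lineality_space (ineq_set K) = {d. \<forall>(a, \<beta>)\<in>H. a \<bullet> d = 0}"
    unfolding lineality_space_ineq_set[OF ne] by (auto simp: H_def)
  have rhs: "\<beta> = 0" if "(a, \<beta>) \<in> H" for a \<beta> using that by (auto simp: H_def)
  define Q where "Q u \<longleftrightarrow> u \<in> ineq_set H \<and> c \<bullet> u > 0" for u
  have "Q d" using d by (simp add: Q_def rec)
  then obtain r where "Q r" and max: "\<And>u'. Q u' \<Longrightarrow> \<not> tight H r \<subset> tight H u'"
    using max_tight_exists[OF finH, of Q] by blast
  then have r: "r \<in> ineq_set H" "c \<bullet> r > 0" by (simp_all add: Q_def)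
  \<comment> \<open>Moving \<open>r\<close> along a level set of \<open>c\<close> keeps it improving, so by maximality it meets no new constraint.\<close>
  have level: "l \<in> lineality_space (ineq_set K)"
    if l: "\<And>a \<beta>. (a, \<beta>) \<in> tight H r \<Longrightarrow> a \<bullet> l = 0" "c \<bullet> l = 0" for l
  proof (rule ccontr)
    assume "l \<notin> lineality_space (ineq_set K)"
    then obtain a \<beta> where K: "(a, \<beta>) \<in> H" "a \<bullet> l \<noteq> 0" unfolding lin by auto
    define l' where "l' = (if a \<bullet> l > 0 then l else - l)"
    have "a \<bullet> l' > 0" using K(2) by (auto simp: l'_def)
    moreover have "a' \<bullet> l' = 0" if "(a', \<beta>') \<in> tight H r" for a' \<beta>'
      using l(1)[OF that] by (simp add: l'_def)
    ultimately have "\<exists>t\<ge>0. r + t *\<^sub>R l' \<in> ineq_set H \<and> tight H r \<subset> tight H (r + t *\<^sub>R l')"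
      by (intro blocked_step[OF finH r(1) _ K(1)])
    then obtain t where "r + t *\<^sub>R l' \<in> ineq_set H" "tight H r \<subset> tight H (r + t *\<^sub>R l')"
      by blast
    moreover have "c \<bullet> (r + t *\<^sub>R l') > 0" using r(2) l(2) by (simp add: inner_simps l'_def)
    ultimately show False using max by (simp add: Q_def)
  qed
  have "extreme_ray_mod (ineq_set K) r"
    unfolding extreme_ray_mod_def rec
  proof (intro conjI ballI impI)
    show "r \<in> ineq_set H" by fact
    show "r \<notin> lineality_space (ineq_set K)" using c r(2) by force
    fix p q assume p: "p \<in> ineq_set H" and q: "q \<in> ineq_set H" and pq: "r = p + q"
    have zero: "a \<bullet> r = 0 \<and> a \<bullet> p = 0" if "(a, \<beta>) \<in> tight H r" for a \<beta>
      using that ineq_setD[OF p, of a \<beta>] ineq_setD[OF q, of a \<beta>] rhs[of a \<beta>]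
      by (auto simp: tight_iff pq inner_simps)
    \<comment> \<open>The multiple of \<open>r\<close> with the same objective value as \<open>p\<close>.\<close>
    define t where "t = (c \<bullet> p) / (c \<bullet> r)"
    have l: "p - t *\<^sub>R r \<in> lineality_space (ineq_set K)"
      using level[of "p - t *\<^sub>R r"] zero r(2) by (simp add: inner_simps t_def)
    show "\<exists>t\<ge>0. p - t *\<^sub>R r \<in> lineality_space (ineq_set K)"
    proof (cases "t \<ge> 0")
      case True
      then show ?thesis using l by blast
    next
      \<comment> \<open>If \<open>p\<close> is a negative multiple of \<open>r\<close> modulo the lineality space, then it lies in that space.\<close>
      case False
      have "a \<bullet> p = 0" if K: "(a, \<beta>) \<in> H" for a \<beta>
      proof -
        have "a \<bullet> p = t * (a \<bullet> r)" using l K unfolding lin by (fastforce simp: inner_simps)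
        moreover have "t * (a \<bullet> r) \<ge> 0"
          using False ineq_setD[OF r(1) K] rhs[OF K] by (simp add: mult_nonpos_nonpos)
        ultimately show ?thesis using ineq_setD[OF p K] rhs[OF K] by simp
      qed
      then have "p - 0 *\<^sub>R r \<in> lineality_space (ineq_set K)" unfolding lin by auto
      then show ?thesis by blast
    qed
  qed
  then show thesis using r(2) by (rule that)
qed

text \<open>An extreme point is determined modulo the lineality space by its tight constraints.\<close>

lemma finite_extreme_points:
  assumes fin: "finite K" and U: "enumerates_extreme_points (ineq_set K) U"
  shows "finite U"
proof -
  have "inj_on (tight K) U"
  proof (rule inj_onI)
    fix u u' assume u: "u \<in> U" "u' \<in> U" and eq: "tight K u = tight K u'"
    have ext: "extreme_point_mod (ineq_set K) u" using U u by (simp add: enumerates_extreme_points_def)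
    have "a \<bullet> (u - u') = 0" if "(a, \<beta>) \<in> tight K u" for a \<beta>
      using that eq tight_iff by (metis inner_diff_right right_minus_eq)
    then have "u - u' \<in> lineality_space (ineq_set K)"
      by (rule extreme_point_mod_tightD[OF fin ext])
    moreover have "u - u \<in> lineality_space (ineq_set K)"
      by (rule extreme_point_mod_tightD[OF fin ext]) simp
    ultimately show "u = u'" using U u ext by (metis enumerates_extreme_points_def)
  qed
  moreover have "finite (tight K ` U)"
    by (rule finite_subset[of _ "Pow K"]) (use fin tight_subset in auto)
  ultimately show ?thesis using finite_imageD by blast
qed

text \<open>
  Outside the lineality space, the rays are determined by the constraints tight at them: if \<open>r\<close> and
  \<open>v\<close> have the same ones, a small multiple of \<open>v\<close> can be split off from \<open>r\<close>. The remaining vectors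
  are those of a basis and their negatives.
\<close>

lemma finite_extreme_rays:
  assumes fin: "finite K" and ne: "ineq_set K \<noteq> {}" and V: "enumerates_extreme_rays (ineq_set K) V"
  shows "finite V"
proof -
  let ?L = "lineality_space (ineq_set K)"
  define H where "H = (\<lambda>(a, \<beta>). (a, 0::real)) ` K"
  have finH: "finite H" using fin by (simp add: H_def)
  have rec: "recession_cone (ineq_set K) = ineq_set H"
    unfolding recession_cone_ineq_set[OF ne] by (auto simp: ineq_set_def H_def)
  have lin: "?L = {d. \<forall>(a, \<beta>)\<in>H. a \<bullet> d = 0}"
    unfolding lineality_space_ineq_set[OF ne] by (auto simp: H_def)
  have rhs: "\<beta> = 0" if "(a, \<beta>) \<in> H" for a \<beta> using that by (auto simp: H_def)
  have ext: "extreme_ray_mod (ineq_set K) v" if "v \<in> V - ?L" for v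
    using V that by (simp add: enumerates_extreme_rays_def)
  have "inj_on (tight H) (V - ?L)"
  proof (rule inj_onI)
    fix r v assume r: "r \<in> V - ?L" and v: "v \<in> V - ?L" and eq: "tight H r = tight H v"
    have rC: "r \<in> ineq_set H" and vC: "v \<in> ineq_set H"
      using ext[OF r] ext[OF v] rec by (auto simp: extreme_ray_mod_def)
    have "a \<bullet> (- v) \<le> 0" if "(a, \<beta>) \<in> tight H r" for a \<beta>
      using that eq rhs[of a \<beta>] by (auto simp: tight_iff)
    then obtain e where e: "e > 0" "\<And>t. 0 \<le> t \<Longrightarrow> t \<le> e \<Longrightarrow> r + t *\<^sub>R (- v) \<in> ineq_set H"
      using feasible_step[OF finH rC, of "- v"] by blast
    have q: "r - e *\<^sub>R v \<in> ineq_set H" using e(2)[of e] e(1) by simp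
    have p: "e *\<^sub>R v \<in> ineq_set H"
    proof (rule ineq_setI)
      fix a \<beta> assume K: "(a, \<beta>) \<in> H"
      show "a \<bullet> (e *\<^sub>R v) \<le> \<beta>"
        using ineq_setD[OF vC K] rhs[OF K] e(1) by (simp add: mult_nonneg_nonpos)
    qed
    have "r = e *\<^sub>R v + (r - e *\<^sub>R v)" by simp
    then obtain t where t: "t \<ge> 0" "e *\<^sub>R v - t *\<^sub>R r \<in> ?L"
      using ext[OF r] p q unfolding extreme_ray_mod_def rec by blast
    have scale: "s *\<^sub>R l \<in> ?L" if "l \<in> ?L" for s l using that unfolding lin by auto
    have "(1 / e) *\<^sub>R (e *\<^sub>R v - t *\<^sub>R r) \<in> ?L" using t scale by blast
    then have vr: "v - (t / e) *\<^sub>R r \<in> ?L" using e(1) by (simp add: algebra_simps)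
    then have "t \<noteq> 0" using v by auto
    then have "t / e > 0" using t(1) e(1) by simp
    moreover note vr
    moreover have "r - 1 *\<^sub>R r \<in> ?L" unfolding lin by simp
    moreover have "(0::real) < 1" by simp
    moreover have "\<exists>!v. v \<in> V - ?L \<and> (\<exists>t>0. v - t *\<^sub>R r \<in> ?L)"
      using V ext[OF r] by (simp add: enumerates_extreme_rays_def)
    ultimately show "r = v" using r v by blast
  qed
  moreover have "finite (tight H ` (V - ?L))"
    by (rule finite_subset[of _ "Pow H"]) (use finH tight_subset in auto)
  ultimately have "finite (V - ?L)" using finite_imageD by blast
  moreover have "finite (V \<inter> ?L)"
    using V unfolding enumerates_extreme_rays_def by (metis finite_Un finite_imageI independent_imp_finite)
  ultimately show ?thesis by (metis Diff_partition Un_Diff_Int finite_Un)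
qed

lemma enumerated_point_optimal:
  assumes fin: "finite K" and ne: "ineq_set K \<noteq> {}"
    and c: "\<And>d. d \<in> recession_cone (ineq_set K) \<Longrightarrow> c \<bullet> d \<le> 0"
    and U: "enumerates_extreme_points (ineq_set K) U"
  shows "\<exists>u\<in>U. u \<in> ineq_set K \<and> (\<forall>z\<in>ineq_set K. c \<bullet> z \<le> c \<bullet> u)"
proof -
  obtain w where w: "extreme_point_mod (ineq_set K) w" "\<And>z. z \<in> ineq_set K \<Longrightarrow> c \<bullet> z \<le> c \<bullet> w"
    using extreme_point_optimal[OF fin ne c] by blast
  obtain u where u: "u \<in> U" "w - u \<in> lineality_space (ineq_set K)"
    using U w(1) unfolding enumerates_extreme_points_def by blast
  have "c \<bullet> (w - u) \<le> 0" using c u(2) by (simp add: lineality_space_def)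
  moreover have "u \<in> ineq_set K"
    using U u(1) by (simp add: enumerates_extreme_points_def extreme_point_mod_def)
  moreover have "c \<bullet> z \<le> c \<bullet> w" if "z \<in> ineq_set K" for z using w(2) that by blast
  ultimately show ?thesis using u(1) by (force simp: inner_simps)
qed

text \<open>
  The basis vectors of the lineality space and their negatives cover the case that \<open>c\<close> does not vanish
  on that space.
\<close>

lemma enumerated_ray_improving:
  assumes fin: "finite K" and ne: "ineq_set K \<noteq> {}"
    and d: "d \<in> recession_cone (ineq_set K)" "c \<bullet> d > 0"
    and V: "enumerates_extreme_rays (ineq_set K) V"
  shows "\<exists>v\<in>V. c \<bullet> v > 0"
proof (cases "\<forall>l\<in>lineality_space (ineq_set K). c \<bullet> l = 0")
  case True
  then obtain r where r: "extreme_ray_mod (ineq_set K) r" "c \<bullet> r > 0"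
    using extreme_ray_improving[OF fin ne d] by blast
  then obtain v t where v: "v \<in> V" "t > 0" "v - t *\<^sub>R r \<in> lineality_space (ineq_set K)"
    using V unfolding enumerates_extreme_rays_def by blast
  then have "c \<bullet> v = t * (c \<bullet> r)" using True by (force simp: inner_simps)
  then have "c \<bullet> v > 0" using v(2) r(2) by simp
  then show ?thesis using v(1) by blast
next
  case False
  obtain B where B: "span B = lineality_space (ineq_set K)"
    "V \<inter> lineality_space (ineq_set K) = B \<union> uminus ` B"
    using V unfolding enumerates_extreme_rays_def by blast
  have "\<exists>b\<in>B. c \<bullet> b \<noteq> 0"
  proof (rule ccontr)
    assume "\<not> ?thesis"
    then have "B \<subseteq> {x. c \<bullet> x = 0}" by auto
    then have "span B \<subseteq> {x. c \<bullet> x = 0}"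
      by (rule span_minimal) (rule subspace_hyperplane)
    then show False using False B(1) by auto
  qed
  then obtain b where b: "b \<in> B" "c \<bullet> b \<noteq> 0" by blast
  have "b \<in> V" "- b \<in> V" using B(2) b(1) by auto
  moreover have "c \<bullet> b > 0 \<or> c \<bullet> (- b) > 0" using b(2) by auto
  ultimately show ?thesis by blast
qed

lemma enumerated_ray_recession:
  assumes "enumerates_extreme_rays P V" "v \<in> V"
  shows "v \<in> recession_cone P"
proof (cases "v \<in> lineality_space P")
  case True
  then show ?thesis by (simp add: lineality_space_def)
next
  case False
  then show ?thesis using assms by (simp add: enumerates_extreme_rays_def extreme_ray_mod_def)
qed

lemma farkas:
  fixes A :: "'e::euclidean_space set"
  assumes "finite A" "c \<notin> convex_cone hull A"
  obtains d where "\<And>a. a \<in> A \<Longrightarrow> a \<bullet> d \<le> 0" "c \<bullet> d > 0"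
proof -
  let ?C = "convex_cone hull A"
  have "closed ?C" using assms(1) by (rule closed_convex_cone_hull)
  then obtain e b where e: "e \<bullet> c < b" "\<And>x. x \<in> ?C \<Longrightarrow> b < e \<bullet> x"
    using separating_hyperplane_closed_point[OF convex_convex_cone_hull _ assms(2)] by blast
  have b: "b < 0" using e(2)[OF convex_cone_hull_contains_0] by simp
  have "e \<bullet> a \<ge> 0" if a: "a \<in> A" for a
  proof (rule ccontr)
    assume "\<not> e \<bullet> a \<ge> 0"
    then have neg: "e \<bullet> a < 0" by simp
    have "(b / (e \<bullet> a)) *\<^sub>R a \<in> ?C"
      using b neg by (intro convex_cone_hull_mul hull_inc a) (simp add: divide_nonpos_neg)
    from e(2)[OF this] show False using neg by simp
  qed
  then show thesis using that[of "- e"] e(1) b by (force simp: inner_commute)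
qed

text \<open>
  The optimality condition of linear programming: otherwise Farkas' lemma yields an improving direction
  that no tight constraint opposes.
\<close>

lemma optimal_in_tight_cone:
  assumes fin: "finite K" and z: "z \<in> ineq_set K" and opt: "\<And>z'. z' \<in> ineq_set K \<Longrightarrow> c \<bullet> z' \<le> c \<bullet> z"
  shows "c \<in> convex_cone hull (fst ` tight K z)"
proof (rule ccontr)
  assume "\<not> ?thesis"
  moreover have "finite (tight K z)" using fin tight_subset finite_subset by blast
  ultimately obtain d where d: "\<And>a. a \<in> fst ` tight K z \<Longrightarrow> a \<bullet> d \<le> 0" "c \<bullet> d > 0"
    using farkas[of "fst ` tight K z" c] by blast
  have "a \<bullet> d \<le> 0" if "(a, \<beta>) \<in> tight K z" for a \<beta> using d(1) that by force
  then obtain e where e: "e > 0" "\<And>t. 0 \<le> t \<Longrightarrow> t \<le> e \<Longrightarrow> z + t *\<^sub>R d \<in> ineq_set K"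
    using feasible_step[OF fin z, of d] by blast
  then have "c \<bullet> (z + e *\<^sub>R d) \<le> c \<bullet> z" by (intro opt) simp
  then show False using e(1) d(2) by (simp add: inner_simps mult_le_0_iff)
qed


section \<open>Duality for the subproblems\<close>

text \<open>
  The column of an arc in the constraint matrix of the subproblem: the entries of its flow variable
  in the flow balance equations and in the side constraints.
\<close>

definition arc_vec :: "('s, 'j, 'k::finite, 'n::finite, 'm::finite, 'r::finite) dd_data \<Rightarrow>
    's \<Rightarrow> 'j \<Rightarrow> 'n \<times> 'n \<Rightarrow> (real^'n) \<times> (real^'m)" where
  "arc_vec D s j = (\<lambda>(m, n). (axis m 1 - axis n 1, fvec D s j (m, n)))"

text \<open>The right-hand side of the subproblem, extended by 0 to indices that are not nodes.\<close>

definition rhs_vec :: "('s, 'j, 'k::finite, 'n::finite, 'm::finite, 'r::finite) dd_data \<Rightarrow>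
    's \<Rightarrow> 'j \<Rightarrow> real^'k \<Rightarrow> (real^'n) \<times> (real^'m)" where
  "rhs_vec D s j x =
     (\<chi> n. if n \<in> nodes D s j then (\<Sum>k\<in>blk D j. bcoef D n s k * x $ k) else 0, hvec D s j)"

text \<open>The left-hand side of the subproblem at the flow \<open>y\<close>.\<close>

definition flow_vec :: "('s, 'j, 'k::finite, 'n::finite, 'm::finite, 'r::finite) dd_data \<Rightarrow>
    's \<Rightarrow> 'j \<Rightarrow> ('n \<times> 'n) set \<Rightarrow> ('n \<times> 'n \<Rightarrow> real) \<Rightarrow> (real^'n) \<times> (real^'m)" where
  "flow_vec D s j E y = (\<Sum>a\<in>E. y a *\<^sub>R arc_vec D s j a)"

text \<open>
  Dual feasibility for an arbitrary arc cost function \<open>w\<close>: the arc costs give the dual polyhedron,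
  zero costs give its recession cone.
\<close>

definition dual_cond :: "('s, 'j, 'k::finite, 'n::finite, 'm::finite, 'r::finite) dd_data \<Rightarrow>
    's \<Rightarrow> 'j \<Rightarrow> ('n \<times> 'n \<Rightarrow> real) \<Rightarrow> ('n \<times> 'n) set \<Rightarrow> (real^'n) \<times> (real^'m) \<Rightarrow> bool" where
  "dual_cond D s j w E z \<longleftrightarrow>
     (\<forall>n. n \<notin> nodes D s j \<longrightarrow> fst z $ n = 0) \<and> (\<forall>i. i \<notin> rows D s j \<longrightarrow> snd z $ i = 0) \<and>
     (\<forall>i\<in>rows D s j. 0 \<le> snd z $ i) \<and> (\<forall>a\<in>E. arc_vec D s j a \<bullet> z \<le> w a)"

text \<open>
  The same conditions as a system of inequalities. The equations for indices that are not nodes or rows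
  are pairs of opposite inequalities, with the sign \<open>\<sigma>\<close>.
\<close>

definition dual_system :: "('s, 'j, 'k::finite, 'n::finite, 'm::finite, 'r::finite) dd_data \<Rightarrow>
    's \<Rightarrow> 'j \<Rightarrow> ('n \<times> 'n \<Rightarrow> real) \<Rightarrow> ('n \<times> 'n) set \<Rightarrow> (((real^'n) \<times> (real^'m)) \<times> real) set" where
  "dual_system D s j w E =
     (\<lambda>a. (arc_vec D s j a, w a)) ` E \<union> (\<lambda>i. ((0, axis i (- 1)), 0)) ` rows D s j \<union>
     (\<lambda>(\<sigma>, n). ((axis n \<sigma>, 0), 0)) ` ({-1, 1} \<times> (- nodes D s j)) \<union>
     (\<lambda>(\<sigma>, i). ((0, axis i \<sigma>), 0)) ` ({-1, 1} \<times> (- rows D s j))"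

lemma finite_dual_system: "finite (dual_system D s j w E)"
  by (simp add: dual_system_def)

lemma arc_vec_inner: "arc_vec D s j (m, n) \<bullet> (\<psi>, \<gamma>) = \<psi> $ m - \<psi> $ n + \<gamma> \<bullet> fvec D s j (m, n)"
  by (simp add: arc_vec_def inner_diff_left inner_axis' inner_commute[of \<gamma>])

lemma reduced_cost_eq: "reduced_cost D s j w z a = w a - arc_vec D s j a \<bullet> z"
  by (cases z; cases a) (simp add: reduced_cost_def arc_vec_inner)

lemma dual_obj_eq: "dual_obj D s j x z = rhs_vec D s j x \<bullet> z"
proof (cases z)
  case (Pair \<psi> \<gamma>)
  have "(\<Sum>n\<in>nodes D s j. \<Sum>k\<in>blk D j. bcoef D n s k * x $ k * \<psi> $ n) =
      (\<Sum>n\<in>UNIV. (if n \<in> nodes D s j then \<Sum>k\<in>blk D j. bcoef D n s k * x $ k else 0) * \<psi> $ n)"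
    by (simp add: sum_distrib_right if_distrib [of "\<lambda>c. c * _"] sum.If_cases cong: if_cong)
  then show ?thesis by (simp add: Pair dual_obj_def rhs_vec_def inner_vec_def)
qed

lemma ineq_set_dual_system: "ineq_set (dual_system D s j w E) = {z. dual_cond D s j w E z}"
  by (auto simp: ineq_set_def dual_system_def dual_cond_def inner_axis' ball_Un order_antisym)

lemma homogeneous_dual_system:
  "{d. \<forall>(a, \<beta>)\<in>dual_system D s j w E. a \<bullet> d \<le> 0} = {d. dual_cond D s j (\<lambda>_. 0) E d}"
  by (auto simp: dual_system_def dual_cond_def inner_axis' ball_Un order_antisym)

lemma dual_poly_cond: "dual_poly D s j E = {z. dual_cond D s j (gcost D s j) E z}"
  by (auto simp: dual_poly_def dual_cond_def arc_vec_inner)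

lemma dual_poly_eq: "dual_poly D s j E = ineq_set (dual_system D s j (gcost D s j) E)"
  by (simp add: dual_poly_cond ineq_set_dual_system)

lemma recession_cone_dual_poly:
  "dual_poly D s j E \<noteq> {} \<Longrightarrow> recession_cone (dual_poly D s j E) = {d. dual_cond D s j (\<lambda>_. 0) E d}"
  by (simp add: dual_poly_eq recession_cone_ineq_set homogeneous_dual_system)

lemma dual_cond_subset: "dual_cond D s j w E z \<Longrightarrow> E' \<subseteq> E \<Longrightarrow> dual_cond D s j w E' z"
  by (auto simp: dual_cond_def)

lemma dual_poly_subset: "E' \<subseteq> E \<Longrightarrow> dual_poly D s j E \<subseteq> dual_poly D s j E'"
  using dual_cond_subset by (auto simp: dual_poly_cond)

lemma flow_vec_fst:
  "fst (flow_vec D s j E y) $ n = (\<Sum>m | (n, m) \<in> E. y (n, m)) - (\<Sum>m | (m, n) \<in> E. y (m, n))"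
proof -
  have "fst (flow_vec D s j E y) $ n =
      (\<Sum>a\<in>E. (if fst a = n then y a else 0) - (if snd a = n then y a else 0))"
    unfolding flow_vec_def fst_sum sum_component
    by (intro sum.cong) (auto simp: arc_vec_def axis_def)
  also have "\<dots> = (\<Sum>a | a \<in> E \<and> fst a = n. y a) - (\<Sum>a | a \<in> E \<and> snd a = n. y a)"
    by (simp add: sum_subtractf sum.inter_filter)
  also have "(\<Sum>a | a \<in> E \<and> fst a = n. y a) = (\<Sum>m | (n, m) \<in> E. y (n, m))"
    by (intro sum.reindex_bij_witness[of _ "\<lambda>m. (n, m)" snd]) auto
  also have "(\<Sum>a | a \<in> E \<and> snd a = n. y a) = (\<Sum>m | (m, n) \<in> E. y (m, n))"
    by (intro sum.reindex_bij_witness[of _ "\<lambda>m. (m, n)" fst]) auto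
  finally show ?thesis .
qed

lemma flow_vec_snd: "snd (flow_vec D s j E y) $ i = (\<Sum>a\<in>E. fvec D s j a $ i * y a)"
  by (auto simp: flow_vec_def snd_sum arc_vec_def mult.commute intro!: sum.cong)

lemma sub_feasible_iff:
  "sub_feasible D s j E x y \<longleftrightarrow>
     (\<forall>n\<in>nodes D s j. fst (flow_vec D s j E y) $ n = fst (rhs_vec D s j x) $ n) \<and>
     (\<forall>i\<in>rows D s j. snd (flow_vec D s j E y) $ i \<ge> snd (rhs_vec D s j x) $ i) \<and>
     (\<forall>a\<in>E. 0 \<le> y a) \<and> (\<forall>a. a \<notin> E \<longrightarrow> y a = 0)"
  unfolding sub_feasible_def flow_balance_def side_constraints_def flow_vec_fst flow_vec_snd
  by (simp add: rhs_vec_def)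

text \<open>
  With the arc costs for \<open>w\<close> this is weak duality, with zero costs it says that no recession direction of
  the dual improves the dual objective if the subproblem is feasible.
\<close>

lemma weak_duality:
  assumes y: "sub_feasible D s j E x y" and z: "dual_cond D s j w E z"
  shows "dual_obj D s j x z \<le> (\<Sum>a\<in>E. w a * y a)"
proof -
  let ?q = "flow_vec D s j E y" and ?c = "rhs_vec D s j x"
  have "fst ?c \<bullet> fst z = fst ?q \<bullet> fst z"
    unfolding inner_vec_def
  proof (rule sum.cong[OF refl])
    fix n
    show "fst ?c $ n \<bullet> fst z $ n = fst ?q $ n \<bullet> fst z $ n"
      using y z by (cases "n \<in> nodes D s j") (auto simp: sub_feasible_iff dual_cond_def)
  qed
  moreover have "snd ?c \<bullet> snd z \<le> snd ?q \<bullet> snd z"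
    unfolding inner_vec_def
  proof (rule sum_mono)
    fix i
    show "snd ?c $ i \<bullet> snd z $ i \<le> snd ?q $ i \<bullet> snd z $ i"
      using y z by (cases "i \<in> rows D s j") (auto simp: sub_feasible_iff dual_cond_def mult_right_mono)
  qed
  ultimately have "dual_obj D s j x z \<le> ?q \<bullet> z" by (simp add: dual_obj_eq inner_prod_def)
  also have "\<dots> = (\<Sum>a\<in>E. y a * (arc_vec D s j a \<bullet> z))"
    by (simp add: flow_vec_def inner_sum_left)
  also have "\<dots> \<le> (\<Sum>a\<in>E. w a * y a)"
  proof (rule sum_mono)
    fix a assume "a \<in> E"
    then have "y a * (arc_vec D s j a \<bullet> z) \<le> y a * w a"
      using y z by (intro mult_left_mono) (auto simp: sub_feasible_iff dual_cond_def)
    then show "y a * (arc_vec D s j a \<bullet> z) \<le> w a * y a" by (simp add: mult.commute)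
  qed
  finally show ?thesis .
qed

lemma weak_duality_poly:
  "sub_feasible D s j E x y \<Longrightarrow> z \<in> dual_poly D s j E \<Longrightarrow> dual_obj D s j x z \<le> arc_cost D s j E y"
  using weak_duality[of D s j E x y "gcost D s j" z] by (simp add: dual_poly_cond arc_cost_def)

text \<open>
  The flow is obtained from the optimality condition of the dual. The right-hand side lies in the
  cone generated by the normals of the tight dual constraints; the set \<open>T\<close> of right-hand sides for
  which there is a flow complementary to the given dual solution is a convex cone containing these
  normals.
\<close>

lemma strong_duality:
  fixes D :: "('s, 'j, 'k::finite, 'n::finite, 'm::finite, 'r::finite) dd_data"
  assumes opt: "dual_optimal D s j E x z"
  obtains y where "sub_feasible D s j E x y" "arc_cost D s j E y = dual_obj D s j x z"
proof -
  let ?K = "dual_system D s j (gcost D s j) E" and ?c = "rhs_vec D s j x"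
  let ?q = "flow_vec D s j E"
  have zP: "z \<in> ineq_set ?K"
    using opt by (simp add: dual_optimal_def is_arg_max_def dual_poly_eq)
  have z: "dual_cond D s j (gcost D s j) E z"
    using zP by (simp add: ineq_set_dual_system)
  have "?c \<bullet> z' \<le> ?c \<bullet> z" if "z' \<in> ineq_set ?K" for z'
    using opt that unfolding dual_optimal_def is_arg_max_linorder dual_poly_eq dual_obj_eq by blast
  then have c: "?c \<in> convex_cone hull (fst ` tight ?K z)"
    by (intro optimal_in_tight_cone finite_dual_system zP)
  \<comment> \<open>\<open>Y p y\<close>: the flow \<open>y\<close> is feasible for the right-hand side \<open>p\<close> and complementary to \<open>z\<close>.\<close>
  define Y where "Y p y \<longleftrightarrow>
     (\<forall>a. 0 \<le> y a) \<and> (\<forall>a. a \<notin> E \<or> arc_vec D s j a \<bullet> z \<noteq> gcost D s j a \<longrightarrow> y a = 0) \<and>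
     (\<forall>n\<in>nodes D s j. fst (?q y) $ n = fst p $ n) \<and>
     (\<forall>i\<in>rows D s j. snd (?q y) $ i \<ge> snd p $ i \<and> (snd z $ i \<noteq> 0 \<longrightarrow> snd (?q y) $ i = snd p $ i))"
    for p :: "(real^'n) \<times> (real^'m)" and y
  define T where "T = {p. \<exists>y. Y p y}"
  have q_add: "?q (\<lambda>a. y a + y' a) = ?q y + ?q y'" for y y'
    by (simp add: flow_vec_def scaleR_add_left sum.distrib)
  have q_scale: "?q (\<lambda>a. t * y a) = t *\<^sub>R ?q y" for t y
    by (simp add: flow_vec_def scaleR_sum_right)
  have q0: "?q (\<lambda>_. 0) = 0" by (simp add: flow_vec_def)
  have "convex_cone T"
    unfolding convex_cone_iff
  proof (intro conjI ballI allI impI)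
    have "Y 0 (\<lambda>_. 0)" by (simp add: Y_def q0)
    then show "0 \<in> T" by (auto simp: T_def)
  next
    fix p p' assume "p \<in> T" "p' \<in> T"
    then obtain y y' where "Y p y" "Y p' y'" by (auto simp: T_def)
    then have "Y (p + p') (\<lambda>a. y a + y' a)" unfolding Y_def q_add by (auto intro: add_mono)
    then show "p + p' \<in> T" by (auto simp: T_def)
  next
    fix p and t :: real assume "p \<in> T" and t: "0 \<le> t"
    then obtain y where "Y p y" by (auto simp: T_def)
    then have "Y (t *\<^sub>R p) (\<lambda>a. t * y a)" unfolding Y_def q_scale using t by (auto intro: mult_left_mono)
    then show "t *\<^sub>R p \<in> T" by (auto simp: T_def)
  qed
  moreover have "fst ` tight ?K z \<subseteq> T"
  proof
    fix p assume "p \<in> fst ` tight ?K z"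
    then obtain \<beta> where K: "(p, \<beta>) \<in> ?K" and tight: "p \<bullet> z = \<beta>" by (auto simp: tight_iff)
    from K consider
      (arc) a where "a \<in> E" "p = arc_vec D s j a" "\<beta> = gcost D s j a"
      | (row) i where "i \<in> rows D s j" "p = (0, axis i (- 1))" "\<beta> = 0"
      | (no_node) \<sigma> n where "n \<notin> nodes D s j" "p = (axis n \<sigma>, 0)"
      | (no_row) \<sigma> i where "i \<notin> rows D s j" "p = (0, axis i \<sigma>)"
      unfolding dual_system_def by auto
    then have "\<exists>y. Y p y"
    proof cases
      case arc
      have "?q (\<lambda>b. if b = a then 1 else 0) = p"
        using arc by (simp add: flow_vec_def if_distrib[of "\<lambda>r. r *\<^sub>R _"] cong: if_cong)
      then have "Y p (\<lambda>b. if b = a then 1 else 0)" using arc tight by (simp add: Y_def)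
      then show ?thesis by blast
    next
      case row
      then have "snd z $ i = 0" using tight by (cases z) (simp add: inner_axis')
      then have "Y p (\<lambda>_. 0)" using row by (auto simp: Y_def q0 axis_def)
      then show ?thesis by blast
    next
      case no_node
      then have "Y p (\<lambda>_. 0)" by (auto simp: Y_def q0 axis_def)
      then show ?thesis by blast
    next
      case no_row
      then have "Y p (\<lambda>_. 0)" by (auto simp: Y_def q0 axis_def)
      then show ?thesis by blast
    qed
    then show "p \<in> T" by (simp add: T_def)
  qed
  ultimately have "?c \<in> T" using c hull_minimal[of "fst ` tight ?K z" T convex_cone] by blast
  then obtain y where y: "Y ?c y" by (auto simp: T_def)
  have "sub_feasible D s j E x y" using y by (auto simp: Y_def sub_feasible_iff)
  moreover have "arc_cost D s j E y = dual_obj D s j x z"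
  proof -
    have "arc_cost D s j E y = (\<Sum>a\<in>E. y a * (arc_vec D s j a \<bullet> z))"
      unfolding arc_cost_def
    proof (rule sum.cong[OF refl])
      fix a
      have "y a = 0" if "arc_vec D s j a \<bullet> z \<noteq> gcost D s j a"
        using y that unfolding Y_def by blast
      then show "gcost D s j a * y a = y a * (arc_vec D s j a \<bullet> z)" by auto
    qed
    also have "\<dots> = ?q y \<bullet> z" by (simp add: flow_vec_def inner_sum_left)
    finally have "arc_cost D s j E y = ?q y \<bullet> z" .
    moreover have "fst (?q y) \<bullet> fst z = fst ?c \<bullet> fst z"
      unfolding inner_vec_def
    proof (rule sum.cong[OF refl])
      fix n
      show "fst (?q y) $ n \<bullet> fst z $ n = fst ?c $ n \<bullet> fst z $ n"
        using y z by (cases "n \<in> nodes D s j") (auto simp: Y_def dual_cond_def)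
    qed
    moreover have "snd (?q y) \<bullet> snd z = snd ?c \<bullet> snd z"
      unfolding inner_vec_def
    proof (rule sum.cong[OF refl])
      fix i
      show "snd (?q y) $ i \<bullet> snd z $ i = snd ?c $ i \<bullet> snd z $ i"
        using y z by (cases "i \<in> rows D s j \<and> snd z $ i \<noteq> 0") (auto simp: Y_def dual_cond_def)
    qed
    ultimately show ?thesis by (simp add: dual_obj_eq inner_prod_def)
  qed
  ultimately show thesis by (rule that)
qed

lemma optimal_pair:
  assumes "sub_feasible D s j E x y" "z \<in> dual_poly D s j E"
    and "arc_cost D s j E y \<le> dual_obj D s j x z"
  shows "sub_optimal D s j E x y" "dual_optimal D s j E x z"
proof -
  have "arc_cost D s j E y \<le> arc_cost D s j E y'" if "sub_feasible D s j E x y'" for y'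
    using assms(3) weak_duality_poly[OF that assms(2)] by simp
  then show "sub_optimal D s j E x y"
    using assms(1) unfolding sub_optimal_def is_arg_min_linorder by blast
  have "dual_obj D s j x z' \<le> dual_obj D s j x z" if "z' \<in> dual_poly D s j E" for z'
    using assms(3) weak_duality_poly[OF assms(1) that] by simp
  then show "dual_optimal D s j E x z"
    using assms(2) unfolding dual_optimal_def is_arg_max_linorder by blast
qed

lemma optimal_values_eq:
  assumes "sub_optimal D s j E x y" "dual_optimal D s j E x z"
  shows "arc_cost D s j E y = dual_obj D s j x z"
proof -
  obtain y' where "sub_feasible D s j E x y'" "arc_cost D s j E y' = dual_obj D s j x z"
    using strong_duality[OF assms(2)] .
  then have "arc_cost D s j E y \<le> dual_obj D s j x z"
    using assms(1) by (force simp: sub_optimal_def is_arg_min_linorder)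
  moreover have "dual_obj D s j x z \<le> arc_cost D s j E y"
    using assms by (intro weak_duality_poly)
      (simp_all add: sub_optimal_def is_arg_min_def dual_optimal_def is_arg_max_def)
  ultimately show ?thesis by simp
qed

lemma feasible_imp_no_improving_direction:
  assumes "dual_poly D s j E \<noteq> {}" "sub_feasible D s j E x y" "d \<in> recession_cone (dual_poly D s j E)"
  shows "dual_obj D s j x d \<le> 0"
proof -
  have "dual_cond D s j (\<lambda>_. 0) E d"
    using assms(3) unfolding recession_cone_dual_poly[OF assms(1)] by simp
  then show ?thesis using weak_duality[OF assms(2)] by fastforce
qed

text \<open>
  As the dual is feasible, the subproblem and its dual both have optimal solutions, or the subproblem
  is infeasible and its dual unbounded.
\<close>

lemma subproblem_cases:
  assumes ne: "dual_poly D s j E \<noteq> {}"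
  shows "(\<exists>y z. sub_optimal D s j E x y \<and> dual_optimal D s j E x z) \<or>
    (\<nexists>y. sub_feasible D s j E x y) \<and> (\<exists>d\<in>recession_cone (dual_poly D s j E). 0 < dual_obj D s j x d)"
proof (cases "\<exists>d\<in>recession_cone (dual_poly D s j E). 0 < dual_obj D s j x d")
  case True
  then have "\<nexists>y. sub_feasible D s j E x y"
    using feasible_imp_no_improving_direction[OF ne] by (meson not_le)
  then show ?thesis using True by blast
next
  case False
  then have nonpos: "rhs_vec D s j x \<bullet> d \<le> 0" if "d \<in> recession_cone (dual_poly D s j E)" for d
    using that by (auto simp: dual_obj_eq not_less)
  have "\<exists>z. extreme_point_mod (dual_poly D s j E) z \<and>
      (\<forall>z'\<in>dual_poly D s j E. rhs_vec D s j x \<bullet> z' \<le> rhs_vec D s j x \<bullet> z)"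
    using ne nonpos unfolding dual_poly_eq by (rule extreme_point_optimal[OF finite_dual_system])
  then obtain z where zP: "z \<in> dual_poly D s j E"
      and max: "\<And>z'. z' \<in> dual_poly D s j E \<Longrightarrow> dual_obj D s j x z' \<le> dual_obj D s j x z"
    by (auto simp: dual_obj_eq extreme_point_mod_def)
  then have z: "dual_optimal D s j E x z"
    unfolding dual_optimal_def is_arg_max_linorder by blast
  then obtain y where y: "sub_feasible D s j E x y" "arc_cost D s j E y = dual_obj D s j x z"
    by (rule strong_duality)
  then have "sub_optimal D s j E x y" by (intro optimal_pair(1)[OF y(1) zP]) simp
  then show ?thesis using z by blast
qed

lemma flow_vec_subset:
  assumes "E \<subseteq> E'" "\<forall>a. a \<notin> E \<longrightarrow> y a = 0"
  shows "flow_vec D s j E' y = flow_vec D s j E y" "arc_cost D s j E' y = arc_cost D s j E y"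
proof -
  show "flow_vec D s j E' y = flow_vec D s j E y"
    unfolding flow_vec_def by (rule sum.mono_neutral_right) (simp_all add: assms(1) assms(2)[rule_format])
  show "arc_cost D s j E' y = arc_cost D s j E y"
    unfolding arc_cost_def by (rule sum.mono_neutral_right) (simp_all add: assms(1) assms(2)[rule_format])
qed

lemma sub_feasible_subset:
  assumes "E \<subseteq> E'" "sub_feasible D s j E x y"
  shows "sub_feasible D s j E' x y" "arc_cost D s j E' y = arc_cost D s j E y"
proof -
  have y0: "\<forall>a. a \<notin> E \<longrightarrow> y a = 0" and ypos: "\<And>a. a \<in> E \<Longrightarrow> 0 \<le> y a"
    using assms(2) unfolding sub_feasible_iff by blast+
  note eq = flow_vec_subset[OF assms(1) y0]
  have "0 \<le> y a" for a using y0[rule_format, of a] ypos[of a] by (cases "a \<in> E") simp_all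
  moreover have "y a = 0" if "a \<notin> E'" for a using y0 that assms(1) by blast
  moreover note assms(2)
  ultimately show "sub_feasible D s j E' x y"
    unfolding sub_feasible_iff eq by blast
  show "arc_cost D s j E' y = arc_cost D s j E y" by (rule eq)
qed


section \<open>Column generation\<close>

lemma priced_dual_exists:
  assumes ne: "dual_poly D s j E \<noteq> {}"
  shows "\<exists>w z. priced_dual D s j E x w z"
  using subproblem_cases[OF ne, of x] unfolding priced_dual_def by blast

lemma priced_dual_cond:
  assumes "dual_poly D s j E \<noteq> {}" "priced_dual D s j E x w z"
  shows "dual_cond D s j w E z"
  using assms(2) recession_cone_dual_poly[OF assms(1)] dual_poly_cond[of D s j E]
  unfolding priced_dual_def dual_optimal_def is_arg_max_def by blast

lemma prices_out_dual_cond: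
  assumes "dual_cond D s j w E z" "prices_out D s j w z"
  shows "dual_cond D s j w (arcs D s j) z"
  using assms unfolding dual_cond_def prices_out_def reduced_cost_eq by auto

text \<open>
  When pricing stops, an optimal flow on the restricted arc set is optimal for the whole subproblem,
  since the dual solution is feasible for all arcs; and if there is no such flow, then the direction of
  unboundedness of the dual is one for all arcs.
\<close>

lemma priced_out_optimal:
  assumes ne: "dual_poly D s j E \<noteq> {}" and E: "E \<subseteq> arcs D s j"
    and pd: "priced_dual D s j E x w z" and out: "prices_out D s j w z"
    and y: "sub_optimal D s j E x y"
  shows "sub_optimal D s j (arcs D s j) x y"
proof -
  have yE: "sub_feasible D s j E x y" using y by (simp add: sub_optimal_def is_arg_min_def)
  then have w: "w = gcost D s j" and z: "dual_optimal D s j E x z"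
    using pd by (auto simp: priced_dual_def)
  have "z \<in> dual_poly D s j (arcs D s j)"
    using prices_out_dual_cond[OF priced_dual_cond[OF ne pd] out] by (simp add: w dual_poly_cond)
  then show ?thesis
    using optimal_pair(1)[of D s j "arcs D s j" x y z] sub_feasible_subset[OF E yE] optimal_values_eq[OF y z]
    by simp
qed

lemma priced_out_feasible:
  assumes ne: "dual_poly D s j E \<noteq> {}"
    and pd: "priced_dual D s j E x w z" and out: "prices_out D s j w z"
    and y: "sub_feasible D s j (arcs D s j) x y"
  shows "\<exists>y. sub_optimal D s j E x y"
proof (rule ccontr)
  assume "\<not> ?thesis"
  then have w: "w = (\<lambda>_. 0)" and pos: "0 < dual_obj D s j x z"
    using pd by (auto simp: priced_dual_def)
  have "dual_cond D s j (\<lambda>_. 0) (arcs D s j) z"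
    using prices_out_dual_cond[OF priced_dual_cond[OF ne pd] out] by (simp add: w)
  then have "dual_obj D s j x z \<le> 0" using weak_duality[OF y] by fastforce
  then show False using pos by simp
qed

lemma pricing_update_exists: "\<exists>E'. pricing_update D s j w z E E'"
proof (cases "prices_out D s j w z")
  case True
  then show ?thesis by (simp add: pricing_update_def)
next
  case False
  then have "arcs D s j \<noteq> {}" by (auto simp: prices_out_def)
  then obtain a where "is_arg_min (reduced_cost D s j w z) (\<lambda>a. a \<in> arcs D s j) a"
    using ex_is_arg_min_if_finite[OF finite, of "arcs D s j" "reduced_cost D s j w z"] by blast
  then show ?thesis unfolding pricing_update_def if_not_P[OF False] by blast
qed

lemma pricing_update_subset:
  assumes "pricing_update D s j w z E E'" "E \<subseteq> arcs D s j"
  shows "E \<subseteq> E'" "E' \<subseteq> arcs D s j"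
  using assms by (auto simp: pricing_update_def is_arg_min_def split: if_splits)

text \<open>
  An arc of negative reduced cost is not in the restricted arc set, whose arcs have nonnegative reduced
  cost by dual feasibility.
\<close>

lemma pricing_update_strict:
  assumes "dual_poly D s j E \<noteq> {}" "priced_dual D s j E x w z" "\<not> prices_out D s j w z"
    "pricing_update D s j w z E E'"
  shows "E \<subset> E'"
proof -
  obtain a where a: "is_arg_min (reduced_cost D s j w z) (\<lambda>a. a \<in> arcs D s j) a" "E' = insert a E"
    using assms(3,4) by (auto simp: pricing_update_def)
  obtain a' where a': "a' \<in> arcs D s j" "reduced_cost D s j w z a' < 0"
    using assms(3) by (auto simp: prices_out_def not_le)
  have "reduced_cost D s j w z a < 0"
    using a(1) a' unfolding is_arg_min_linorder by (meson le_less_trans)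
  moreover have "0 \<le> reduced_cost D s j w z b" if "b \<in> E" for b
    using priced_dual_cond[OF assms(1,2)] that by (auto simp: dual_cond_def reduced_cost_eq)
  ultimately have "a \<notin> E" using not_le by blast
  then show ?thesis using a(2) by blast
qed


section \<open>Convergence of the algorithm\<close>

lemma miolo_value_eq:
  assumes "miolo_optimal D p"
  shows "ereal (total_cost D p) = miolo_value D"
  unfolding miolo_value_def
proof (rule antisym)
  show "ereal (total_cost D p) \<le> (INF p\<in>{p. miolo_feasible D p}. ereal (total_cost D p))"
    using assms by (intro INF_greatest) (auto simp: miolo_optimal_def is_arg_min_linorder)
  show "(INF p\<in>{p. miolo_feasible D p}. ereal (total_cost D p)) \<le> ereal (total_cost D p)"
    using assms by (intro INF_lower) (auto simp: miolo_optimal_def is_arg_min_linorder)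
qed

lemma miolo_value_le_star_value:
  assumes "dd_instance D"
  shows "miolo_value D \<le> star_value D"
proof -
  have "miolo_feasible D (x, y)" if "star_feasible D (x, y)" for x y
  proof -
    have "0 \<le> y s j a" if "a \<in> arcs D s j" for s j a
    proof -
      have "y s j a \<in> ydom D s j a"
        using \<open>star_feasible D (x, y)\<close> that by (simp add: star_feasible_def second_feasible_def)
      moreover have "ydom D s j a \<subseteq> {0..}" using assms that by (simp add: dd_instance_def)
      ultimately show ?thesis by auto
    qed
    then show ?thesis
      using that by (simp add: miolo_feasible_def star_feasible_def second_feasible_def sub_feasible_def)
  qed
  then show ?thesis
    unfolding miolo_value_def star_value_def by (intro INF_superset_mono) auto
qed

text \<open>
  An instance with feasible duals and enumerations \<open>U\<close> and \<open>V\<close> of their extreme points and rays.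
\<close>

locale dd_run =
  fixes D :: "('s::finite, 'j::finite, 'k::finite, 'n::finite, 'm::finite, 'r::finite) dd_data"
    and U V :: "'s \<Rightarrow> 'j \<Rightarrow> ((real^'n) \<times> (real^'m)) set"
  assumes inst: "dd_instance D"
    and dual_feasible: "dual_poly D s j (arcs D s j) \<noteq> {}"
    and extreme_points: "enumerates_extreme_points (dual_poly D s j (arcs D s j)) (U s j)"
    and extreme_rays: "enumerates_extreme_rays (dual_poly D s j (arcs D s j)) (V s j)"
begin

lemma prob_nonneg: "0 \<le> scen_prob D s"
  using inst by (simp add: dd_instance_def)

lemma restricted_dual_feasible: "E \<subseteq> arcs D s j \<Longrightarrow> dual_poly D s j E \<noteq> {}"
  using dual_feasible[of s j] dual_poly_subset[of E "arcs D s j" D s j] by blast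

lemma finite_U: "finite (U s j)"
  by (rule finite_extreme_points[OF finite_dual_system extreme_points[unfolded dual_poly_eq]])

lemma finite_V: "finite (V s j)"
  by (rule finite_extreme_rays[OF finite_dual_system dual_feasible[unfolded dual_poly_eq]
      extreme_rays[unfolded dual_poly_eq]])

lemma point_cut_valid:
  assumes "u \<in> U s j" "sub_feasible D s j (arcs D s j) x y"
  shows "dual_obj D s j x u \<le> arc_cost D s j (arcs D s j) y"
proof (rule weak_duality_poly[OF assms(2)])
  show "u \<in> dual_poly D s j (arcs D s j)"
    using extreme_points[of s j] assms(1)
    by (simp add: enumerates_extreme_points_def extreme_point_mod_def)
qed

lemma ray_cut_valid:
  assumes "v \<in> V s j" "sub_feasible D s j (arcs D s j) x y"
  shows "dual_obj D s j x v \<le> 0"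
  by (rule feasible_imp_no_improving_direction[OF dual_feasible assms(2)
      enumerated_ray_recession[OF extreme_rays assms(1)]])

text \<open>The master problem is a relaxation of the problem with continuous second stage.\<close>

lemma master_relaxation:
  assumes "\<And>s j. Uc s j \<subseteq> U s j" "\<And>s j. Vc s j \<subseteq> V s j" "miolo_feasible D (x, y)"
  defines "\<theta> \<equiv> \<lambda>s j. arc_cost D s j (arcs D s j) (y s j)"
  shows "master_feasible D Uc Vc (x, \<theta>)" "master_cost D (x, \<theta>) = total_cost D (x, y)"
proof -
  have y: "first_stage D x" "sub_feasible D s j (arcs D s j) x (y s j)" for s j
    using assms(3) by (auto simp: miolo_feasible_def)
  show "master_feasible D Uc Vc (x, \<theta>)"
    using y point_cut_valid ray_cut_valid assms(1,2)
    unfolding master_feasible_def cuts_hold_def \<theta>_def by blast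
  show "master_cost D (x, \<theta>) = total_cost D (x, y)"
    by (simp add: master_cost_def total_cost_def second_cost_def \<theta>_def)
qed

lemma cut_update_exists: "\<exists>Uc' Vc'. cut_update D s j (U s j) (V s j) x Uc Vc Uc' Vc'"
proof -
  let ?P = "dual_poly D s j (arcs D s j)" and ?K = "dual_system D s j (gcost D s j) (arcs D s j)"
  let ?c = "rhs_vec D s j x"
  show ?thesis
  proof (cases "\<exists>y. sub_optimal D s j (arcs D s j) x y")
    case True
    then obtain y where "sub_feasible D s j (arcs D s j) x y"
      by (auto simp: sub_optimal_def is_arg_min_def)
    then have "?c \<bullet> d \<le> 0" if "d \<in> recession_cone ?P" for d
      using feasible_imp_no_improving_direction[OF dual_feasible] that by (simp add: dual_obj_eq)
    then obtain u where u: "u \<in> U s j" "u \<in> ?P" "\<And>z. z \<in> ?P \<Longrightarrow> ?c \<bullet> z \<le> ?c \<bullet> u"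
      using enumerated_point_optimal[OF finite_dual_system, of D s j "gcost D s j" "arcs D s j" ?c "U s j"]
        dual_feasible[of s j] extreme_points[of s j] unfolding dual_poly_eq by blast
    then have "dual_optimal D s j (arcs D s j) x u"
      by (simp add: dual_optimal_def is_arg_max_linorder dual_obj_eq)
    then show ?thesis using True u(1) by (auto simp: cut_update_def)
  next
    case False
    then obtain d where "d \<in> recession_cone ?P" "0 < ?c \<bullet> d"
      using subproblem_cases[OF dual_feasible, of s j x] unfolding dual_obj_eq by blast
    then obtain v where "v \<in> V s j" "0 < ?c \<bullet> v"
      using enumerated_ray_improving[OF finite_dual_system, of D s j "gcost D s j" "arcs D s j" d ?c "V s j"]
        dual_feasible[of s j] extreme_rays[of s j] unfolding dual_poly_eq by blast
    then show ?thesis using False by (auto simp: cut_update_def dual_obj_eq)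
  qed
qed

lemma cut_update_subset:
  assumes "cut_update D s j (U s j) (V s j) x Uc Vc Uc' Vc'" "Uc \<subseteq> U s j" "Vc \<subseteq> V s j"
  shows "Uc \<subseteq> Uc'" "Vc \<subseteq> Vc'" "Uc' \<subseteq> U s j" "Vc' \<subseteq> V s j"
  using assms unfolding cut_update_def by (auto split: if_splits)

text \<open>
  If the newly generated cuts hold, then no subproblem has received a feasibility cut, since such a cut
  is violated by construction, and the optimality cuts bound the costs of the subproblems by \<open>\<theta>\<close>.
\<close>

lemma no_violated_cut:
  assumes upd: "cut_update D s j (U s j) (V s j) x (Uc s j) (Vc s j) (Uc' s j) (Vc' s j)"
    and cuts: "cuts_hold D Uc' Vc' x \<theta>"
  shows "\<exists>y. sub_optimal D s j (arcs D s j) x y"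
    and "sub_optimal D s j (arcs D s j) x y \<Longrightarrow> arc_cost D s j (arcs D s j) y \<le> \<theta> s j"
proof -
  show ex: "\<exists>y. sub_optimal D s j (arcs D s j) x y"
  proof (rule ccontr)
    assume no: "\<not> ?thesis"
    obtain v where "v \<in> Vc' s j" "0 < dual_obj D s j x v"
      using upd unfolding cut_update_def if_not_P[OF no] by blast
    then show False using cuts unfolding cuts_hold_def by (meson not_le)
  qed
  assume y: "sub_optimal D s j (arcs D s j) x y"
  obtain u where "u \<in> Uc' s j" "dual_optimal D s j (arcs D s j) x u"
    using upd unfolding cut_update_def if_P[OF ex] by blast
  then show "arc_cost D s j (arcs D s j) y \<le> \<theta> s j"
    using cuts optimal_values_eq[OF y] unfolding cuts_hold_def by auto
qed

lemma termination_optimal: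
  assumes sub: "\<And>s j. Uc s j \<subseteq> U s j" "\<And>s j. Vc s j \<subseteq> V s j"
    and opt: "master_optimal D Uc Vc (x, \<theta>)"
    and y: "\<And>s j. sub_optimal D s j (arcs D s j) x (y s j)"
    and le: "\<And>s j. arc_cost D s j (arcs D s j) (y s j) \<le> \<theta> s j"
  shows "miolo_optimal D (x, y)"
  unfolding miolo_optimal_def is_arg_min_linorder
proof (intro conjI allI impI)
  show "miolo_feasible D (x, y)"
    using opt y by (auto simp: miolo_feasible_def master_optimal_def is_arg_min_def
        master_feasible_def sub_optimal_def)
  fix p assume p: "miolo_feasible D p"
  obtain x' y' where p': "p = (x', y')" by (cases p)
  have "total_cost D (x, y) \<le> master_cost D (x, \<theta>)"
    unfolding total_cost_def master_cost_def second_cost_def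
    using le by (auto intro!: sum_mono mult_left_mono prob_nonneg)
  also have "\<dots> \<le> master_cost D (x', \<lambda>s j. arc_cost D s j (arcs D s j) (y' s j))"
    using opt master_relaxation(1)[OF sub p[unfolded p']]
    unfolding master_optimal_def is_arg_min_linorder by blast
  also have "\<dots> = total_cost D p"
    unfolding p' by (rule master_relaxation(2)[OF sub p[unfolded p']])
  finally show "total_cost D (x, y) \<le> total_cost D p" .
qed

text \<open>
  The invariant of a run: the generated cuts and arcs are actual ones, the inner loop works at an optimal
  solution of the current master problem, and the final states are correct.
\<close>

fun invar :: "('s, 'j, 'k, 'n, 'm) dd_state \<Rightarrow> bool" where
  "invar (Master Uc Vc E) \<longleftrightarrow> (\<forall>s j. Uc s j \<subseteq> U s j \<and> Vc s j \<subseteq> V s j \<and> E s j \<subseteq> arcs D s j)"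
| "invar (Inner Uc Vc E x \<theta>) \<longleftrightarrow>
     (\<forall>s j. Uc s j \<subseteq> U s j \<and> Vc s j \<subseteq> V s j \<and> E s j \<subseteq> arcs D s j) \<and> master_optimal D Uc Vc (x, \<theta>)"
| "invar Infeasible \<longleftrightarrow> (\<nexists>p. miolo_feasible D p)"
| "invar (Terminated x y) \<longleftrightarrow> miolo_optimal D (x, y)"
| "invar (Returned x y y') \<longleftrightarrow> miolo_optimal D (x, y) \<and> second_optimal D x y'"

lemma invar_step:
  assumes "dd_step D U V \<sigma> \<sigma>'" "invar \<sigma>"
  shows "invar \<sigma>'"
  using assms
proof (cases rule: dd_step.cases)
  case (master_infeasible Uc Vc E)
  have sub: "\<And>s j. Uc s j \<subseteq> U s j" "\<And>s j. Vc s j \<subseteq> V s j"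
    using assms(2) master_infeasible by auto
  have "\<not> miolo_feasible D p" for p
    using master_relaxation(1)[OF sub] master_infeasible(3) by (cases p) blast
  then show ?thesis using master_infeasible by simp
next
  case (master_solve Uc Vc x \<theta> E)
  then show ?thesis using assms(2) by simp
next
  case (price E x w z E' Uc Vc \<theta>)
  then have "\<And>s j. E' s j \<subseteq> arcs D s j"
    using assms(2) pricing_update_subset(2) by (metis invar.simps(2))
  then show ?thesis using assms(2) price by simp
next
  case (add_cuts E x w z Uc Vc Uc' Vc' \<theta>)
  then have inv: "\<And>s j. Uc s j \<subseteq> U s j" "\<And>s j. Vc s j \<subseteq> V s j" "\<And>s j. E s j \<subseteq> arcs D s j"
    using assms(2) by auto
  have "Uc' s j \<subseteq> U s j" "Vc' s j \<subseteq> V s j" for s j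
    using cut_update_subset(3,4)[OF add_cuts(5)[rule_format, of s j] inv(1,2)] by simp_all
  then show ?thesis using inv add_cuts by simp
next
  case (terminate E x w z Uc Vc Uc' Vc' \<theta> y)
  then have inv: "\<And>s j. Uc s j \<subseteq> U s j" "\<And>s j. Vc s j \<subseteq> V s j" "\<And>s j. E s j \<subseteq> arcs D s j"
    and opt: "master_optimal D Uc Vc (x, \<theta>)"
    using assms(2) by auto
  have y: "sub_optimal D s j (arcs D s j) x (y s j)" for s j
    using priced_out_optimal[OF restricted_dual_feasible[OF inv(3)] inv(3)] terminate by blast
  have "arc_cost D s j (arcs D s j) (y s j) \<le> \<theta> s j" for s j
    using no_violated_cut(2) terminate(5,6) y by blast
  then have "miolo_optimal D (x, y)" using termination_optimal[OF inv(1,2) opt y] by blast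
  then show ?thesis using terminate by simp
next
  case (integer_second_stage x y' y)
  then show ?thesis using assms(2) by simp
qed

text \<open>The inner loop never gets stuck.\<close>

lemma inner_progress:
  assumes inv: "invar (Inner Uc Vc E x \<theta>)"
  shows "\<exists>\<sigma>. dd_step D U V (Inner Uc Vc E x \<theta>) \<sigma>"
proof -
  have E: "E s j \<subseteq> arcs D s j" for s j using inv by simp
  note ne = restricted_dual_feasible[OF E]
  have "\<forall>s j. \<exists>w z. priced_dual D s j (E s j) x w z" using priced_dual_exists[OF ne] by blast
  then obtain w z where pd: "\<forall>s j. priced_dual D s j (E s j) x (w s j) (z s j)" by metis
  show ?thesis
  proof (cases "\<forall>s j. prices_out D s j (w s j) (z s j)")
    case False
    have "\<forall>s j. \<exists>E'. pricing_update D s j (w s j) (z s j) (E s j) E'"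
      by (intro allI pricing_update_exists)
    then obtain E' where "\<forall>s j. pricing_update D s j (w s j) (z s j) (E s j) (E' s j)" by metis
    then show ?thesis using dd_step.price[OF pd] False by blast
  next
    case True
    have "\<forall>s j. \<exists>Uc' Vc'. cut_update D s j (U s j) (V s j) x (Uc s j) (Vc s j) Uc' Vc'"
      using cut_update_exists by blast
    then obtain Uc' Vc' where
      upd: "\<forall>s j. cut_update D s j (U s j) (V s j) x (Uc s j) (Vc s j) (Uc' s j) (Vc' s j)"
      by metis
    show ?thesis
    proof (cases "cuts_hold D Uc' Vc' x \<theta>")
      case False
      then show ?thesis using dd_step.add_cuts[OF pd True upd] by blast
    next
      case cuts: True
      have "\<exists>y. sub_optimal D s j (E s j) x y" for s j
      proof -
        obtain y where "sub_optimal D s j (arcs D s j) x y"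
          using no_violated_cut(1) upd cuts by blast
        then have "sub_feasible D s j (arcs D s j) x y" by (simp add: sub_optimal_def is_arg_min_def)
        then show ?thesis using priced_out_feasible[OF ne] pd True by blast
      qed
      then obtain y where "\<forall>s j. sub_optimal D s j (E s j) x (y s j)" by metis
      then show ?thesis using dd_step.terminate[OF pd True upd cuts] by blast
    qed
  qed
qed

text \<open>What a family \<open>B\<close> of sets leaves out of the family \<open>A\<close>.\<close>

definition left_out :: "('s \<Rightarrow> 'j \<Rightarrow> 'x set) \<Rightarrow> ('s \<Rightarrow> 'j \<Rightarrow> 'x set) \<Rightarrow> (('s \<times> 'j) \<times> 'x) set" where
  "left_out A B = (SIGMA p:UNIV. A (fst p) (snd p) - B (fst p) (snd p))"

lemma card_left_out_mono:
  assumes "\<And>s j. finite (A s j)" "\<And>s j. B s j \<subseteq> B' s j"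
  shows "card (left_out A B') \<le> card (left_out A B)"
proof (rule card_mono)
  show "finite (left_out A B)" using assms(1) by (auto simp: left_out_def)
  show "left_out A B' \<subseteq> left_out A B" using assms(2) by (auto simp: left_out_def)
qed

lemma card_left_out_strict:
  assumes "\<And>s j. finite (A s j)" "\<And>s j. B s j \<subseteq> B' s j" "b \<in> A s j" "b \<in> B' s j" "b \<notin> B s j"
  shows "card (left_out A B') < card (left_out A B)"
proof (rule psubset_card_mono)
  show "finite (left_out A B)" using assms(1) by (auto simp: left_out_def)
  have "((s, j), b) \<in> left_out A B - left_out A B'" using assms by (auto simp: left_out_def)
  moreover have "left_out A B' \<subseteq> left_out A B" using assms(2) by (auto simp: left_out_def)
  ultimately show "left_out A B' \<subset> left_out A B" by blast
qed

text \<open>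
  The components of a lexicographic measure that decreases along a run: the remaining stages, the
  cuts not yet generated, whether the master problem is still to be solved, and the arcs not yet
  generated.
\<close>

fun stages :: "('s, 'j, 'k, 'n, 'm) dd_state \<Rightarrow> nat" where
  "stages (Master Uc Vc E) = 2"
| "stages (Inner Uc Vc E x \<theta>) = 2"
| "stages Infeasible = 0"
| "stages (Terminated x y) = 1"
| "stages (Returned x y y') = 0"

fun cuts_left :: "('s, 'j, 'k, 'n, 'm) dd_state \<Rightarrow> nat" where
  "cuts_left (Master Uc Vc E) = card (left_out U Uc) + card (left_out V Vc)"
| "cuts_left (Inner Uc Vc E x \<theta>) = card (left_out U Uc) + card (left_out V Vc)"
| "cuts_left _ = 0"

fun master_pending :: "('s, 'j, 'k, 'n, 'm) dd_state \<Rightarrow> nat" where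
  "master_pending (Master Uc Vc E) = 1"
| "master_pending _ = 0"

fun arcs_left :: "('s, 'j, 'k, 'n, 'm) dd_state \<Rightarrow> nat" where
  "arcs_left (Inner Uc Vc E x \<theta>) = card (left_out (arcs D) E)"
| "arcs_left _ = 0"

lemma step_decreases:
  assumes "dd_step D U V \<sigma> \<sigma>'" "invar \<sigma>"
  shows "(\<sigma>', \<sigma>) \<in> measures [stages, cuts_left, master_pending, arcs_left]"
  using assms
proof (cases rule: dd_step.cases)
  case (price E x w z E' Uc Vc \<theta>)
  have E: "E s j \<subseteq> arcs D s j" for s j using assms(2) price(1) by simp
  have mono: "E s j \<subseteq> E' s j" "E' s j \<subseteq> arcs D s j" for s j
    using pricing_update_subset[OF _ E] price(5) by blast+
  obtain s j where "\<not> prices_out D s j (w s j) (z s j)" using price(4) by blast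
  then have "E s j \<subset> E' s j"
    using pricing_update_strict[OF restricted_dual_feasible[OF E]] price(3,5) by blast
  then obtain a where a: "a \<in> E' s j" "a \<notin> E s j" by blast
  have "a \<in> arcs D s j" using a(1) mono(2) by blast
  then have "card (left_out (arcs D) E') < card (left_out (arcs D) E)"
    using mono(1) a by (intro card_left_out_strict[of _ _ _ a s j]) auto
  then show ?thesis using price by simp
next
  case (add_cuts E x w z Uc Vc Uc' Vc' \<theta>)
  have sub: "Uc s j \<subseteq> U s j" "Vc s j \<subseteq> V s j" for s j
    using assms(2) add_cuts(1) by simp_all
  have mono: "Uc s j \<subseteq> Uc' s j" "Vc s j \<subseteq> Vc' s j" "Uc' s j \<subseteq> U s j" "Vc' s j \<subseteq> V s j" for s j
    using cut_update_subset[OF add_cuts(5)[rule_format, of s j] sub] by simp_all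
  \<comment> \<open>The master solution satisfies all old cuts, so the violated one is new.\<close>
  have "cuts_hold D Uc Vc x \<theta>"
    using assms(2) add_cuts(1) by (simp add: master_optimal_def is_arg_min_def master_feasible_def)
  then have "(\<exists>s j u. u \<in> Uc' s j \<and> u \<notin> Uc s j) \<or> (\<exists>s j v. v \<in> Vc' s j \<and> v \<notin> Vc s j)"
    using add_cuts(6) unfolding cuts_hold_def by metis
  moreover note card_left_out_mono[OF finite_U, of Uc Uc'] card_left_out_mono[OF finite_V, of Vc Vc']
    card_left_out_strict[OF finite_U, of Uc Uc'] card_left_out_strict[OF finite_V, of Vc Vc']
  ultimately have "card (left_out U Uc') + card (left_out V Vc') < card (left_out U Uc) + card (left_out V Vc)"
    using mono by (meson add_le_less_mono add_less_le_mono subsetD)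
  then show ?thesis using add_cuts by simp
qed auto

lemma no_infinite_run:
  assumes "invar (\<sigma> 0)" "\<And>i. dd_step D U V (\<sigma> i) (\<sigma> (Suc i))"
  shows False
proof -
  have "invar (\<sigma> i)" for i by (induction i) (use assms invar_step in blast)+
  then have "(\<sigma> (Suc i), \<sigma> i) \<in> measures [stages, cuts_left, master_pending, arcs_left]" for i
    using step_decreases assms(2) by blast
  then show False using wf_iff_no_infinite_down_chain wf_measures by blast
qed

end

theorem theorem1:
  fixes D :: "('s::finite, 'j::finite, 'k::finite, 'n::finite, 'm::finite, 'r::finite) dd_data"
    and U V U0 V0 :: "'s \<Rightarrow> 'j \<Rightarrow> ((real^'n) \<times> (real^'m)) set"
    and E0 :: "'s \<Rightarrow> 'j \<Rightarrow> ('n \<times> 'n) set"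
  assumes inst: "dd_instance D"
    and dual_feasible: "\<And>s j. dual_poly D s j (arcs D s j) \<noteq> {}"
    and extreme_points: "\<And>s j. enumerates_extreme_points (dual_poly D s j (arcs D s j)) (U s j)"
    and extreme_rays: "\<And>s j. enumerates_extreme_rays (dual_poly D s j (arcs D s j)) (V s j)"
    and initial: "\<And>s j. U0 s j \<subseteq> U s j" "\<And>s j. V0 s j \<subseteq> V s j" "\<And>s j. E0 s j \<subseteq> arcs D s j"
    and master_solvable: "\<And>Uc Vc E p.
      (dd_step D U V)\<^sup>*\<^sup>* (Master U0 V0 E0) (Master Uc Vc E) \<Longrightarrow> master_feasible D Uc Vc p \<Longrightarrow>
      \<exists>p'. master_optimal D Uc Vc p'"
  shows "(\<nexists>\<sigma>. \<sigma> 0 = Master U0 V0 E0 \<and> (\<forall>i::nat. dd_step D U V (\<sigma> i) (\<sigma> (Suc i)))) \<and>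
    (\<forall>\<sigma>. (dd_step D U V)\<^sup>*\<^sup>* (Master U0 V0 E0) \<sigma> \<and> (\<nexists>\<sigma>'. dd_step D U V \<sigma> \<sigma>') \<longrightarrow>
      (case \<sigma> of
        Infeasible \<Rightarrow> \<nexists>p. miolo_feasible D p
      | Terminated x y \<Rightarrow>
          miolo_optimal D (x, y) \<and>
          ereal (total_cost D (x, y)) = miolo_value D \<and> miolo_value D \<le> star_value D \<and>
          (\<nexists>y'. second_optimal D x y')
      | Returned x y y' \<Rightarrow>
          miolo_optimal D (x, y) \<and> star_feasible D (x, y') \<and>
          ereal (total_cost D (x, y)) = miolo_value D \<and>
          miolo_value D \<le> star_value D \<and> star_value D \<le> ereal (total_cost D (x, y'))
      | Master Uc Vc E \<Rightarrow> False
      | Inner Uc Vc E x \<theta> \<Rightarrow> False))"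
proof -
  interpret dd_run D U V
    by unfold_locales (fact inst dual_feasible extreme_points extreme_rays)+
  have init: "invar (Master U0 V0 E0)" using initial by simp
  show ?thesis
  proof (intro conjI allI impI)
    show "\<nexists>\<sigma>. \<sigma> 0 = Master U0 V0 E0 \<and> (\<forall>i::nat. dd_step D U V (\<sigma> i) (\<sigma> (Suc i)))"
      using no_infinite_run init by metis
    fix \<sigma> assume run: "(dd_step D U V)\<^sup>*\<^sup>* (Master U0 V0 E0) \<sigma> \<and> (\<nexists>\<sigma>'. dd_step D U V \<sigma> \<sigma>')"
    then have reach: "(dd_step D U V)\<^sup>*\<^sup>* (Master U0 V0 E0) \<sigma>"
      and stuck: "\<And>\<sigma>'. \<not> dd_step D U V \<sigma> \<sigma>'" by auto
    have inv: "invar \<sigma>"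
      using reach by (induction rule: rtranclp_induct) (use init invar_step in blast)+
    show "case \<sigma> of
        Infeasible \<Rightarrow> \<nexists>p. miolo_feasible D p
      | Terminated x y \<Rightarrow>
          miolo_optimal D (x, y) \<and>
          ereal (total_cost D (x, y)) = miolo_value D \<and> miolo_value D \<le> star_value D \<and>
          (\<nexists>y'. second_optimal D x y')
      | Returned x y y' \<Rightarrow>
          miolo_optimal D (x, y) \<and> star_feasible D (x, y') \<and>
          ereal (total_cost D (x, y)) = miolo_value D \<and>
          miolo_value D \<le> star_value D \<and> star_value D \<le> ereal (total_cost D (x, y'))
      | Master Uc Vc E \<Rightarrow> False
      | Inner Uc Vc E x \<theta> \<Rightarrow> False"
    proof (cases \<sigma>)
      case (Master Uc Vc E)
      have "\<exists>\<sigma>'. dd_step D U V (Master Uc Vc E) \<sigma>'"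
      proof (cases "\<exists>p. master_feasible D Uc Vc p")
        case True
        then obtain x \<theta> where "master_optimal D Uc Vc (x, \<theta>)"
          using master_solvable reach unfolding Master by (metis surj_pair)
        then show ?thesis using dd_step.master_solve by blast
      next
        case False
        then show ?thesis using dd_step.master_infeasible by blast
      qed
      then show ?thesis using stuck Master by blast
    next
      case (Inner Uc Vc E x \<theta>)
      then show ?thesis using inner_progress inv stuck by blast
    next
      case Infeasible
      then show ?thesis using inv by simp
    next
      case (Terminated x y)
      then have "\<not> second_optimal D x y'" for y' using stuck dd_step.integer_second_stage by blast
      then show ?thesis
        using Terminated inv miolo_value_eq miolo_value_le_star_value[OF inst] by simp
    next
      case (Returned x y y')
      then have opt: "miolo_optimal D (x, y)" and "second_optimal D x y'" using inv by auto
      then have star: "star_feasible D (x, y')"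
        by (simp add: miolo_optimal_def second_optimal_def is_arg_min_def miolo_feasible_def
            star_feasible_def)
      then have "star_value D \<le> ereal (total_cost D (x, y'))"
        unfolding star_value_def by (intro INF_lower) simp
      then show ?thesis
        using Returned opt star miolo_value_eq miolo_value_le_star_value[OF inst] by simp
    qed
  qed
qed

end
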